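(* Let $d\ge3$, $n\ge2$ be integers and let $(\mathbb B,b)$ be the complex defined in the context. The differentials of $\mathbb B$ are explicitly given by the following formulas. (a) (i) If $m\in\binom{x_2,\dots,x_d}{n-1}$, then $m^*\in K_{0,n-1}U_0$ and $b_1(m^* )=\sum_{m_1\in\binom{x_1,\dots,x_d}{n-1}}x_1m_1Q_{m_1,m}$. (ii) If $m\in\binom{x_2,\dots,x_d}{n}$, then $m\in L_{0,n}U_0$ and $b_1(m)=\pmb\delta m-\sum_{m_1\in\binom{x_1,\dots,x_d}{n-2}}\sum_{m_2\in\binom{x_1,\dots,x_d}{n-1}}x_1m_2Q_{m_2,x_1m_1}t_{m_1m}$. (b) Let $2\le r\le d-1$. (i) If $\theta\in\bigwedge^rU_0$ and $m\in\binom{x_2,\dots,x_d}{n}$, then $\eta(\theta\otimes m^* )\in K_{r-1,n-1}U_0$ and $b_r(\eta(\theta\otimes m^* ))$ has component $$-\sum_{j=2}^d\sum_{m_1\in\binom{x_1,\dots,x_d}{n-2}}\sum_{m_2\in\binom{x_2,\dots,x_d}{n}}\chi(x_j|m)x_1t_{m_1m_2}Q_{x_1m_1,\frac m{x_j}}\otimes\eta(x_j^*(\theta)\otimes m_2^* )-\pmb\delta\sum_{j=2}^dx_j\otimes\eta(x_j^*(\theta)\otimes m^* )$$ in $\mathfrak R\otimes K_{r-2,n-1}U_0$ and component $$-\sum_{j=2}^d\sum_{m_1\in\binom{x_2,\dots,x_d}{n-1}}\chi(x_j|m)x_1Q_{m_1,\frac m{x_j}}\otimes\kappa(x_j^*(\theta)\otimes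 m_1)$$ in $\mathfrak R\otimes L_{r-2,n}U_0$. (ii) If $\theta\in\bigwedge^rU_0$ and $m\in\binom{x_2,\dots,x_d}{n-1}$, then $\kappa(\theta\otimes m)\in L_{r-1,n}U_0$ and $b_r(\kappa(\theta\otimes m))$ has component $$\sum_{j=2}^d\sum_{m_1,m_2\in\binom{x_1,\dots,x_d}{n-2}}\sum_{m_3\in\binom{x_2,\dots,x_d}{n}}x_1t_{x_jmm_2}Q_{x_1m_1,x_1m_2}t_{m_1m_3}\otimes\eta(x_j^*(\theta)\otimes m_3^* )$$ in $\mathfrak R\otimes K_{r-2,n-1}U_0$ and component $$\sum_{j=2}^d\sum_{m_1\in\binom{x_2,\dots,x_d}{n-1}}\sum_{m_2\in\binom{x_1,\dots,x_d}{n-2}}x_1t_{x_jmm_2}Q_{m_1,x_1m_2}\otimes\kappa(x_j^*(\theta)\otimes m_1)-\pmb\delta\sum_{j=2}^dx_j\otimes\kappa(x_j^*(\theta)\otimes m)$$ in $\mathfrak R\otimes L_{r-2,n}U_0$. (c) If $\theta\in\bigwedge^{d-1}U_0$, then $\theta\in B_d$ and $b_d(\theta)$ has component $$\sum_{m\in\binom{x_2,\dots,x_d}{n}}\Big[\pmb\delta m-\sum_{m_1\in\binom{x_1,\dots,x_d}{n-2}}\sum_{m_2\in\binom{x_1,\dots,x_d}{n-1}}x_1m_2Q_{m_2,x_1m_1}t_{m_1m}\Big]\otimes\eta(\theta\otimes m^* )$$ in $\mathfrak R\otimes K_{d-2,n-1}U_0$ and component $$-\sum_{m\in\binom{x_2,\dots,x_d}{n-1}}\sum_{m_1\in\binom{x_1,\dots,x_d}{n-1}}x_1m_1Q_{m_1,m}\otimes\kappa(\theta\otimes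 m)$$ in $\mathfrak R\otimes L_{d-2,n}U_0$.
   Context: Notation. Unadorned $\otimes,\bigwedge,\operatorname{Sym},D$ (divided powers), $(\ )^*$ are over $\mathbb Z$. $U$ is a free $\mathbb Z$-module with basis $x_1,\dots,x_d$, dual basis $x_1^*,\dots,x_d^*$ of $U^*$; $U_0=\bigoplus_{i\ge2}\mathbb Zx_i$, $U_0^*=\bigoplus_{i\ge2}\mathbb Zx_i^*$. $\operatorname{Sym}_\bullet U$ acts on $D_\bullet(U^* )$ (the graded dual of $\operatorname{Sym}_\bullet U$) by contraction. $U^*$ acts on $\bigwedge^\bullet U$ by $u^*(u_1\wedge\dots\wedge u_r)=\sum_i(-1)^{i+1}u^*(u_i)\,u_1\wedge\dots\widehat{u_i}\dots\wedge u_r$. $\binom{x_i,\dots,x_d}{s}$ is the set of monomials of degree $s$ in $x_i,\dots,x_d$; for $m=x_1^{a_1}\cdots x_d^{a_d}$, $m^*={x_1^*}^{(a_1)}\cdots{x_d^*}^{(a_d)}$. $\mathfrak R=\operatorname{Sym}_\bullet(U\oplus\operatorname{Sym}_{2n-2}U)$ is the polynomial ring $\mathbb Z[x_1,\dots,x_d,\{t_m\mid m\in\binom{x_1,\dots,x_d}{2n-2}\}]$, where $t_m$ is the element $m$ of the summand $\operatorname{Sym}_{2n-2}U$. $\Phi=\sum_mt_m\otimes m^*\in\mathfrak R\otimes D_{2n-2}(U^* )$ and $\widetilde\Phi=\sum_mt_m\otimes(x_1m)^*\in\mathfrak R\otimes D_{2n-1}(U^* )$ (sums over $m\in\binom{x_1,\dots,x_d}{2n-2}$).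 $T=(t_{m_1m_2})$, with $m_1,m_2$ running over $\binom{x_1,\dots,x_d}{n-1}$ in the same order; $\pmb\delta=\det T$; $Q=(Q_{m_1,m_2})$ is the classical adjoint of $T$; $q:D_{n-1}(U^* )\to\mathfrak R\otimes\operatorname{Sym}_{n-1}U$ is the classical adjoint of the map $\mu\mapsto\mu(\Phi)$, i.e. $q(m_2^* )=\sum_{m_1}Q_{m_1,m_2}\otimes m_1$. $\kappa(\theta\otimes\mu)=\sum_{i=1}^d x_i^*(\theta)\otimes x_i\mu$ and $\eta(\theta\otimes\nu)=\sum_{i=1}^d x_i^*(\theta)\otimes x_i(\nu)$ for $\theta\in\bigwedge^aU$, $\mu\in\operatorname{Sym}_bU$, $\nu\in D_b(U^* )$; $L_{a,b}U_0=\ker(\kappa:\bigwedge^aU_0\otimes\operatorname{Sym}_bU_0\to\bigwedge^{a-1}U_0\otimes\operatorname{Sym}_{b+1}U_0)$, $K_{a,b}U_0=\ker(\eta:\bigwedge^aU_0\otimes D_b(U_0^* )\to\bigwedge^{a-1}U_0\otimes D_{b-1}(U_0^* ))$. Maps are extended $\mathfrak R$-linearly; an element of $\operatorname{Sym}_\bullet U$ is viewed in $\mathfrak R$ when a value in $\mathfrak R$ is required. $\chi(\text{statement})$ is $1$ if the statement is true and $0$ if false (a product containing $\chi(x_j|m)=0$ is $0$). The complex $(\mathbb B,b)$: $B_0=\mathfrak R$; $B_r=\mathfrak R\otimes(K_{r-1,n-1}U_0\oplus L_{r-1,n}U_0)$ for $1\le r\le d-1$; $B_d=\mathfrak R\otimes\bigwedge^{d-1}U_0$.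 Let $\operatorname{proj}:\operatorname{Sym}_{n-1}U\to\operatorname{Sym}_{n-1}U_0$ be induced by the projection $U\to U_0$ killing $x_1$, and $\mathrm{Kos}(\theta)=\sum_{i=1}^dx_i\otimes x_i^*(\theta)$. $b_1(\nu)=x_1q(\nu)$ for $\nu\in K_{0,n-1}U_0=D_{n-1}(U_0^* )$; $b_1(\mu)=\pmb\delta\mu-x_1q(\mu(\widetilde\Phi))$ for $\mu\in L_{0,n}U_0=\operatorname{Sym}_nU_0$. For $2\le r\le d-1$, $\sum_i\theta_i\otimes\nu_i\in K_{r-1,n-1}U_0$: $b_r(\sum_i\theta_i\otimes\nu_i)$ has component $-x_1\otimes\sum_i\eta(\theta_i\otimes[q(\nu_i)](\widetilde\Phi))+\pmb\delta\sum_i\mathrm{Kos}(\theta_i)\otimes\nu_i$ in $\mathfrak R\otimes K_{r-2,n-1}U_0$ and $-x_1\otimes\sum_i\kappa(\theta_i\otimes\operatorname{proj}(q(\nu_i)))$ in $\mathfrak R\otimes L_{r-2,n}U_0$. For $2\le r\le d-1$, $\sum_i\theta_i\otimes\mu_i\in L_{r-1,n}U_0$: $b_r(\sum_i\theta_i\otimes\mu_i)$ has component $x_1\otimes\sum_i\eta(\theta_i\otimes[q(\mu_i(\widetilde\Phi))](\widetilde\Phi))$ in $\mathfrak R\otimes K_{r-2,n-1}U_0$ and $x_1\otimes\sum_i\kappa(\theta_i\otimes\operatorname{proj}(q(\mu_i(\widetilde\Phi))))+\pmb\delta\sum_i\mathrm{Kos}(\theta_i)\otimes\mu_i$ in $\mathfrak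 R\otimes L_{r-2,n}U_0$. For $\omega\in\bigwedge^{d-1}U_0$: $b_d(\omega)$ has component $\sum_{m\in\binom{x_2,\dots,x_d}{n}}[\pmb\delta m-x_1q(m(\widetilde\Phi))]\otimes\eta(\omega\otimes m^* )$ in $\mathfrak R\otimes K_{d-2,n-1}U_0$ and $-\sum_{m\in\binom{x_2,\dots,x_d}{n-1}}x_1q(m^* )\otimes\kappa(\omega\otimes m)$ in $\mathfrak R\otimes L_{d-2,n}U_0$. *)

theory Defs
  imports
    "HOL-Library.Poly_Mapping"
    "Jordan_Normal_Form.Determinant"
begin

section \<open>Monomials and free modules\<close>

text \<open>
  A monomial in \<open>x\<^sub>1, x\<^sub>2, \<dots>\<close> is its exponent vector, so the product of monomials
  is \<open>+\<close>.  A free module over \<open>'a\<close> with basis \<open>B\<close> is \<open>B \<Rightarrow>\<^sub>0 'a\<close>.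
  The following encodings are used, with \<open>'a = int\<close> for modules over the integers
  and \<open>'a = rpoly\<close> (below) after tensoring with the ring \<open>\<RR>\<close> of the complex:
  \<^item> \<open>Sym U\<close>: \<open>mon \<Rightarrow>\<^sub>0 'a\<close>, with \<open>bvec m\<close> the monomial \<open>m\<close>; multiplication is the
    convolution product of \<open>\<Rightarrow>\<^sub>0\<close>.
  \<^item> \<open>D(U*)\<close>, the graded dual of \<open>Sym U\<close>: also \<open>mon \<Rightarrow>\<^sub>0 'a\<close>, with \<open>bvec m\<close> the
    element \<open>m*\<close> of the basis dual to the monomials.  (The convolution product is not the
    divided power product and is never applied to elements of \<open>D(U*)\<close>.)
  \<^item> \<open>\<And>U\<close>: \<open>nat set \<Rightarrow>\<^sub>0 'a\<close>, with \<open>bvec {s\<^sub>1 < \<dots> < s\<^sub>r}\<close> the element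
    \<open>x\<^bsub>s\<^sub>1\<^esub> \<and> \<dots> \<and> x\<^bsub>s\<^sub>r\<^esub>\<close>.
  \<^item> The tensor product of free modules with bases \<open>B\<close> and \<open>C\<close> is free on \<open>B \<times> C\<close>.
\<close>

type_synonym mon = "nat \<Rightarrow>\<^sub>0 nat"

definition xm :: "nat \<Rightarrow> mon" where
  "xm i = Poly_Mapping.single i 1"

definition mdeg :: "mon \<Rightarrow> nat" where
  "mdeg m = (\<Sum>i\<in>Poly_Mapping.keys m. Poly_Mapping.lookup m i)"

text \<open>\<open>mons i d s\<close> is the set of monomials of degree \<open>s\<close> in \<open>x\<^sub>i, \<dots>, x\<^sub>d\<close>.\<close>

definition mons :: "nat \<Rightarrow> nat \<Rightarrow> nat \<Rightarrow> mon set" where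
  "mons i d s = {m. Poly_Mapping.keys m \<subseteq> {i..d} \<and> mdeg m = s}"

text \<open>Divisibility of monomials; the library order on \<open>mon\<close> is lexicographic, not this one.\<close>

definition mdvd :: "mon \<Rightarrow> mon \<Rightarrow> bool" where
  "mdvd m k \<longleftrightarrow> (\<exists>l. k = m + l)"

definition bvec :: "'b \<Rightarrow> ('b \<Rightarrow>\<^sub>0 'a::comm_ring_1)" where
  "bvec b = Poly_Mapping.single b 1"

definition smul :: "'a::comm_ring_1 \<Rightarrow> ('b \<Rightarrow>\<^sub>0 'a) \<Rightarrow> ('b \<Rightarrow>\<^sub>0 'a)" (infixr "\<cdot>\<^sub>s" 73) where
  "c \<cdot>\<^sub>s z = Poly_Mapping.map (\<lambda>a. c * a) z"

text \<open>The linear map with given values on a basis.\<close>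

definition linext ::
    "('b \<Rightarrow> ('c \<Rightarrow>\<^sub>0 'a::comm_ring_1)) \<Rightarrow> ('b \<Rightarrow>\<^sub>0 'a) \<Rightarrow> ('c \<Rightarrow>\<^sub>0 'a)" where
  "linext f z = (\<Sum>b\<in>Poly_Mapping.keys z. Poly_Mapping.lookup z b \<cdot>\<^sub>s f b)"

definition tensor ::
    "('b \<Rightarrow>\<^sub>0 'a::comm_ring_1) \<Rightarrow> ('c \<Rightarrow>\<^sub>0 'a) \<Rightarrow> ('b \<times> 'c \<Rightarrow>\<^sub>0 'a)" (infixl "\<otimes>\<^sub>t" 74) where
  "u \<otimes>\<^sub>t v = (\<Sum>b\<in>Poly_Mapping.keys u. \<Sum>c\<in>Poly_Mapping.keys v.
      Poly_Mapping.single (b, c) (Poly_Mapping.lookup u b * Poly_Mapping.lookup v c))"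


section \<open>The actions and the maps kappa and eta\<close>

text \<open>
  The action of \<open>Sym U\<close> on \<open>D(U*)\<close>: since \<open>(m(k*))(m') = k*(m m')\<close>, the element
  \<open>m(k*)\<close> is \<open>(k/m)*\<close> if \<open>m\<close> divides \<open>k\<close>, and \<open>0\<close> otherwise.
\<close>

definition contr :: "(mon \<Rightarrow>\<^sub>0 'a::comm_ring_1) \<Rightarrow> (mon \<Rightarrow>\<^sub>0 'a) \<Rightarrow> (mon \<Rightarrow>\<^sub>0 'a)" where
  "contr \<mu> \<nu> =
     linext (\<lambda>m. linext (\<lambda>k. if mdvd m k then bvec (k - m) else 0) \<nu>) \<mu>"

text \<open>The action of \<open>x\<^sub>i*\<close> on \<open>\<And>U\<close>.\<close>

definition der :: "nat \<Rightarrow> (nat set \<Rightarrow>\<^sub>0 'a::comm_ring_1) \<Rightarrow> (nat set \<Rightarrow>\<^sub>0 'a)" where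
  "der i = linext (\<lambda>S. if i \<in> S then (- 1) ^ card {j \<in> S. j < i} \<cdot>\<^sub>s bvec (S - {i}) else 0)"

definition kappa :: "nat \<Rightarrow> (nat set \<times> mon \<Rightarrow>\<^sub>0 'a::comm_ring_1) \<Rightarrow> (nat set \<times> mon \<Rightarrow>\<^sub>0 'a)" where
  "kappa d = linext (\<lambda>(S, m). \<Sum>i=1..d. der i (bvec S) \<otimes>\<^sub>t (bvec (xm i) * bvec m))"

definition eta :: "nat \<Rightarrow> (nat set \<times> mon \<Rightarrow>\<^sub>0 'a::comm_ring_1) \<Rightarrow> (nat set \<times> mon \<Rightarrow>\<^sub>0 'a)" where
  "eta d = linext (\<lambda>(S, m). \<Sum>i=1..d. der i (bvec S) \<otimes>\<^sub>t contr (bvec (xm i)) (bvec m))"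

definition wedge0 :: "nat \<Rightarrow> nat \<Rightarrow> (nat set \<Rightarrow>\<^sub>0 int) set" where
  "wedge0 d a = {\<theta>. Poly_Mapping.keys \<theta> \<subseteq> {S. S \<subseteq> {2..d} \<and> card S = a}}"

text \<open>
  In the chosen bases this set is both \<open>\<And>\<^sup>a U\<^sub>0 \<otimes> Sym\<^sub>b U\<^sub>0\<close> and
  \<open>\<And>\<^sup>a U\<^sub>0 \<otimes> D\<^sub>b(U\<^sub>0*)\<close>.
\<close>

definition wedge0_tensor :: "nat \<Rightarrow> nat \<Rightarrow> nat \<Rightarrow> (nat set \<times> mon \<Rightarrow>\<^sub>0 int) set" where
  "wedge0_tensor d a b =
     {z. Poly_Mapping.keys z \<subseteq> {S. S \<subseteq> {2..d} \<and> card S = a} \<times> mons 2 d b}"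

text \<open>For \<open>a = 0\<close> the maps vanish, because \<open>der i (bvec {}) = 0\<close>.\<close>

definition Lmod :: "nat \<Rightarrow> nat \<Rightarrow> nat \<Rightarrow> (nat set \<times> mon \<Rightarrow>\<^sub>0 int) set" where
  "Lmod d a b = {z \<in> wedge0_tensor d a b. kappa d z = 0}"

definition Kmod :: "nat \<Rightarrow> nat \<Rightarrow> nat \<Rightarrow> (nat set \<times> mon \<Rightarrow>\<^sub>0 int) set" where
  "Kmod d a b = {z \<in> wedge0_tensor d a b. eta d z = 0}"


section \<open>The ring of the complex, the matrix T and its classical adjoint\<close>

text \<open>
  The type \<open>rpoly\<close> is the integral polynomial ring in all \<open>x\<^sub>i\<close> and all \<open>t\<^sub>m\<close>; the ring
  \<open>\<RR>\<close> of the complex is its subring \<open>Rset d n\<close> of polynomials in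
  \<open>x\<^sub>1, \<dots>, x\<^sub>d\<close> and the \<open>t\<^sub>m\<close> with \<open>m\<close> of degree \<open>2n - 2\<close> in \<open>x\<^sub>1, \<dots>, x\<^sub>d\<close>.
\<close>

datatype gen = GX nat | GT mon

type_synonym rpoly = "(gen \<Rightarrow>\<^sub>0 nat) \<Rightarrow>\<^sub>0 int"

definition rvar :: "gen \<Rightarrow> rpoly" where
  "rvar g = Poly_Mapping.single (Poly_Mapping.single g 1) 1"

definition rx :: "nat \<Rightarrow> rpoly" where
  "rx i = rvar (GX i)"

definition rt :: "mon \<Rightarrow> rpoly" where
  "rt m = rvar (GT m)"

definition Rset :: "nat \<Rightarrow> nat \<Rightarrow> rpoly set" where
  "Rset d n = {p. \<forall>e\<in>Poly_Mapping.keys p.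
      Poly_Mapping.keys e \<subseteq> GX ` {1..d} \<union> GT ` mons 1 d (2 * n - 2)}"

text \<open>Elements of \<open>Sym U\<close>, and of \<open>\<RR> \<otimes> Sym U\<close>, viewed in \<open>\<RR>\<close>.\<close>

definition rmon :: "mon \<Rightarrow> rpoly" where
  "rmon m = (\<Prod>i\<in>Poly_Mapping.keys m. rx i ^ Poly_Mapping.lookup m i)"

definition in_R :: "(mon \<Rightarrow>\<^sub>0 rpoly) \<Rightarrow> rpoly" where
  "in_R u = (\<Sum>m\<in>Poly_Mapping.keys u. Poly_Mapping.lookup u m * rmon m)"

text \<open>
  The rows and columns of \<open>T\<close> are listed in the same (lexicographic) order of the
  monomials of degree \<open>n - 1\<close>; \<open>mon_pos d n m\<close> is the position of \<open>m\<close> in this list.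
\<close>

definition mon_list :: "nat \<Rightarrow> nat \<Rightarrow> mon list" where
  "mon_list d n = sorted_list_of_set (mons 1 d (n - 1))"

definition mon_pos :: "nat \<Rightarrow> nat \<Rightarrow> mon \<Rightarrow> nat" where
  "mon_pos d n m = inv_into {..<length (mon_list d n)} ((!) (mon_list d n)) m"

definition Tmat :: "nat \<Rightarrow> nat \<Rightarrow> rpoly mat" where
  "Tmat d n = mat (length (mon_list d n)) (length (mon_list d n))
     (\<lambda>(i, j). rt (mon_list d n ! i + mon_list d n ! j))"

definition delta :: "nat \<Rightarrow> nat \<Rightarrow> rpoly" where
  "delta d n = det (Tmat d n)"

definition Q :: "nat \<Rightarrow> nat \<Rightarrow> mon \<Rightarrow> mon \<Rightarrow> rpoly" where
  "Q d n m1 m2 = adj_mat (Tmat d n) $$ (mon_pos d n m1, mon_pos d n m2)"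

text \<open>The map \<open>q\<close>, extended linearly from \<open>D\<^bsub>n-1\<^esub>(U*)\<close> to \<open>\<RR> \<otimes> D\<^bsub>n-1\<^esub>(U*)\<close>.\<close>

definition q :: "nat \<Rightarrow> nat \<Rightarrow> (mon \<Rightarrow>\<^sub>0 rpoly) \<Rightarrow> (mon \<Rightarrow>\<^sub>0 rpoly)" where
  "q d n = linext (\<lambda>m2. \<Sum>m1\<in>mons 1 d (n - 1). Q d n m1 m2 \<cdot>\<^sub>s bvec m1)"

definition Phi_tilde :: "nat \<Rightarrow> nat \<Rightarrow> (mon \<Rightarrow>\<^sub>0 rpoly)" where
  "Phi_tilde d n = (\<Sum>m\<in>mons 1 d (2 * n - 2). rt m \<cdot>\<^sub>s bvec (xm 1 + m))"


section \<open>The modules of the complex\<close>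

text \<open>\<open>bc z\<close> is \<open>1 \<otimes> z\<close>.\<close>

definition bc :: "('b \<Rightarrow>\<^sub>0 int) \<Rightarrow> ('b \<Rightarrow>\<^sub>0 rpoly)" where
  "bc z = Poly_Mapping.map of_int z"

text \<open>
  \<open>\<RR> \<otimes> M\<close> for a submodule \<open>M\<close> of a free module.  Since \<open>\<RR>\<close> is free over the
  integers, \<open>\<RR> \<otimes> M\<close> is identified with its image in the free \<open>\<RR>\<close>-module, the
  \<open>\<RR>\<close>-span of \<open>M\<close>.
\<close>

definition Rtensor :: "nat \<Rightarrow> nat \<Rightarrow> ('b \<Rightarrow>\<^sub>0 int) set \<Rightarrow> ('b \<Rightarrow>\<^sub>0 rpoly) set" where
  "Rtensor d n M =
     {\<Sum>z\<in>F. c z \<cdot>\<^sub>s bc z | F c. finite F \<and> F \<subseteq> M \<and> (\<forall>z\<in>F. c z \<in> Rset d n)}"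

text \<open>The modules \<open>B\<^sub>0\<close>, \<open>B\<^sub>r\<close> for \<open>1 \<le> r \<le> d - 1\<close>, and \<open>B\<^sub>d\<close>; a direct sum is a product of sets.\<close>

definition B_zero :: "nat \<Rightarrow> nat \<Rightarrow> rpoly set" where
  "B_zero d n = Rset d n"

definition B_mid :: "nat \<Rightarrow> nat \<Rightarrow> nat \<Rightarrow>
    ((nat set \<times> mon \<Rightarrow>\<^sub>0 rpoly) \<times> (nat set \<times> mon \<Rightarrow>\<^sub>0 rpoly)) set" where
  "B_mid d n r = Rtensor d n (Kmod d (r - 1) (n - 1)) \<times> Rtensor d n (Lmod d (r - 1) n)"

definition B_top :: "nat \<Rightarrow> nat \<Rightarrow> (nat set \<Rightarrow>\<^sub>0 rpoly) set" where
  "B_top d n = Rtensor d n (wedge0 d (d - 1))"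


section \<open>The differentials of the complex\<close>

text \<open>Induced by the projection of \<open>U\<close> onto \<open>U\<^sub>0\<close> killing \<open>x\<^sub>1\<close>.\<close>

definition proj0 :: "(mon \<Rightarrow>\<^sub>0 rpoly) \<Rightarrow> (mon \<Rightarrow>\<^sub>0 rpoly)" where
  "proj0 = linext (\<lambda>m. if mdvd (xm 1) m then 0 else bvec m)"

text \<open>\<open>Kos(\<theta>)\<close> with its factor from \<open>U\<close> viewed in \<open>\<RR>\<close>.\<close>

definition Kos :: "nat \<Rightarrow> (nat set \<Rightarrow>\<^sub>0 rpoly) \<Rightarrow> (nat set \<Rightarrow>\<^sub>0 rpoly)" where
  "Kos d \<theta> = (\<Sum>i=1..d. rx i \<cdot>\<^sub>s der i \<theta>)"

definition b_oneK :: "nat \<Rightarrow> nat \<Rightarrow> (mon \<Rightarrow>\<^sub>0 rpoly) \<Rightarrow> rpoly" where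
  "b_oneK d n \<nu> = rx 1 * in_R (q d n \<nu>)"

definition b_oneL :: "nat \<Rightarrow> nat \<Rightarrow> (mon \<Rightarrow>\<^sub>0 rpoly) \<Rightarrow> rpoly" where
  "b_oneL d n \<mu> = delta d n * in_R \<mu> - rx 1 * in_R (q d n (contr \<mu> (Phi_tilde d n)))"

text \<open>
  \<open>K\<^bsub>0,n-1\<^esub>U\<^sub>0\<close> lies in \<open>\<And>\<^sup>0 U\<^sub>0 \<otimes> D\<^bsub>n-1\<^esub>(U\<^sub>0*)\<close>, so that
  only pairs with \<open>S = {}\<close> occur below; similarly for \<open>L\<^bsub>0,n\<^esub>U\<^sub>0\<close>.
\<close>

definition b_one :: "nat \<Rightarrow> nat \<Rightarrow>
    (nat set \<times> mon \<Rightarrow>\<^sub>0 rpoly) \<times> (nat set \<times> mon \<Rightarrow>\<^sub>0 rpoly) \<Rightarrow> rpoly" where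
  "b_one d n = (\<lambda>(z, w).
     (\<Sum>(S, m)\<in>Poly_Mapping.keys z. Poly_Mapping.lookup z (S, m) * b_oneK d n (bvec m)) +
     (\<Sum>(S, m)\<in>Poly_Mapping.keys w. Poly_Mapping.lookup w (S, m) * b_oneL d n (bvec m)))"

text \<open>
  The components of \<open>b\<^sub>r\<close>, \<open>2 \<le> r \<le> d - 1\<close>, as bilinear expressions in the two tensor
  factors; \<open>b_KL\<close> leads from the summand \<open>K\<close> to the summand \<open>L\<close>, etc.  They are defined
  on all of \<open>\<And>U\<^sub>0 \<otimes> D(U\<^sub>0*)\<close> and \<open>\<And>U\<^sub>0 \<otimes> Sym U\<^sub>0\<close>; the differential is
  the restriction to \<open>B_mid d n r\<close>, and only there does it take values in \<open>B_mid d n (r - 1)\<close>.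
\<close>

definition b_KK :: "nat \<Rightarrow> nat \<Rightarrow> (nat set \<Rightarrow>\<^sub>0 rpoly) \<Rightarrow> (mon \<Rightarrow>\<^sub>0 rpoly) \<Rightarrow> (nat set \<times> mon \<Rightarrow>\<^sub>0 rpoly)" where
  "b_KK d n \<theta> \<nu> =
     - (rx 1 \<cdot>\<^sub>s eta d (\<theta> \<otimes>\<^sub>t contr (q d n \<nu>) (Phi_tilde d n)))
     + delta d n \<cdot>\<^sub>s (Kos d \<theta> \<otimes>\<^sub>t \<nu>)"

definition b_KL :: "nat \<Rightarrow> nat \<Rightarrow> (nat set \<Rightarrow>\<^sub>0 rpoly) \<Rightarrow> (mon \<Rightarrow>\<^sub>0 rpoly) \<Rightarrow> (nat set \<times> mon \<Rightarrow>\<^sub>0 rpoly)" where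
  "b_KL d n \<theta> \<nu> = - (rx 1 \<cdot>\<^sub>s kappa d (\<theta> \<otimes>\<^sub>t proj0 (q d n \<nu>)))"

definition b_LK :: "nat \<Rightarrow> nat \<Rightarrow> (nat set \<Rightarrow>\<^sub>0 rpoly) \<Rightarrow> (mon \<Rightarrow>\<^sub>0 rpoly) \<Rightarrow> (nat set \<times> mon \<Rightarrow>\<^sub>0 rpoly)" where
  "b_LK d n \<theta> \<mu> =
     rx 1 \<cdot>\<^sub>s eta d (\<theta> \<otimes>\<^sub>t contr (q d n (contr \<mu> (Phi_tilde d n))) (Phi_tilde d n))"

definition b_LL :: "nat \<Rightarrow> nat \<Rightarrow> (nat set \<Rightarrow>\<^sub>0 rpoly) \<Rightarrow> (mon \<Rightarrow>\<^sub>0 rpoly) \<Rightarrow> (nat set \<times> mon \<Rightarrow>\<^sub>0 rpoly)" where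
  "b_LL d n \<theta> \<mu> =
     rx 1 \<cdot>\<^sub>s kappa d (\<theta> \<otimes>\<^sub>t proj0 (q d n (contr \<mu> (Phi_tilde d n))))
     + delta d n \<cdot>\<^sub>s (Kos d \<theta> \<otimes>\<^sub>t \<mu>)"

text \<open>The formula for \<open>b\<^sub>r\<close> does not depend on \<open>r\<close>, only its source and target do.\<close>

definition b_mid :: "nat \<Rightarrow> nat \<Rightarrow>
    (nat set \<times> mon \<Rightarrow>\<^sub>0 rpoly) \<times> (nat set \<times> mon \<Rightarrow>\<^sub>0 rpoly) \<Rightarrow>
    (nat set \<times> mon \<Rightarrow>\<^sub>0 rpoly) \<times> (nat set \<times> mon \<Rightarrow>\<^sub>0 rpoly)" where
  "b_mid d n = (\<lambda>(z, w).
     (linext (\<lambda>(S, m). b_KK d n (bvec S) (bvec m)) z +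
      linext (\<lambda>(S, m). b_LK d n (bvec S) (bvec m)) w,
      linext (\<lambda>(S, m). b_KL d n (bvec S) (bvec m)) z +
      linext (\<lambda>(S, m). b_LL d n (bvec S) (bvec m)) w))"

definition b_top :: "nat \<Rightarrow> nat \<Rightarrow> (nat set \<Rightarrow>\<^sub>0 rpoly) \<Rightarrow>
    (nat set \<times> mon \<Rightarrow>\<^sub>0 rpoly) \<times> (nat set \<times> mon \<Rightarrow>\<^sub>0 rpoly)" where
  "b_top d n \<omega> =
     (\<Sum>m\<in>mons 2 d n.
        (delta d n * rmon m - rx 1 * in_R (q d n (contr (bvec m) (Phi_tilde d n))))
          \<cdot>\<^sub>s eta d (\<omega> \<otimes>\<^sub>t bvec m),
      - (\<Sum>m\<in>mons 2 d (n - 1). (rx 1 * in_R (q d n (bvec m))) \<cdot>\<^sub>s kappa d (\<omega> \<otimes>\<^sub>t bvec m)))"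

end

theory Submission
  imports Defs
begin

text \<open>
  Each differential is linear, and the generators in question are values of \<open>\<eta>\<close> and
  \<open>\<kappa>\<close>: for \<open>\<theta>\<close> with \<open>x\<^sub>1*(\<theta>) = 0\<close>,
  \<open>\<eta>(\<theta> \<otimes> m*) = \<Sum>\<^sub>j x\<^sub>j*(\<theta>) \<otimes> x\<^sub>j(m*)\<close> and
  \<open>\<kappa>(\<theta> \<otimes> m) = \<Sum>\<^sub>j x\<^sub>j*(\<theta>) \<otimes> x\<^sub>j m\<close>, where \<open>j\<close> runs over
  \<open>2, \<dots>, d\<close>.  Substituting these sums into the definitions of the differentials gives sums of
  the required shape, up to three observations.

  \<^item> For \<open>m*\<close> in \<open>D\<^bsub>n-1\<^esub>(U*)\<close>, the element \<open>[q(m*)](\<Phi>~)\<close> is the sum of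
    \<open>\<delta> (x\<^sub>1 m)*\<close> and of a combination of the \<open>m\<^sub>2*\<close> with \<open>m\<^sub>2\<close> free of \<open>x\<^sub>1\<close>
    (lemma \<open>contr_q_Phi_tilde\<close>).  Indeed, the coefficient of \<open>(x\<^sub>1 k)*\<close> is an entry of the
    product of \<open>T\<close> and its classical adjoint.
  \<^item> The contributions of the summand \<open>\<delta> (x\<^sub>1 m)*\<close> cancel: their sum is a multiple of
    \<open>\<eta>(\<eta>(\<theta> \<otimes> \<nu>))\<close> for a suitable \<open>\<nu>\<close>, and \<open>\<eta> \<circ> \<eta> = 0\<close> because the
    operators \<open>x\<^sub>i*\<close> anticommute and square to zero while contractions commute.  Here
    \<open>\<nu> = (x\<^sub>1 m)*\<close> in lemma \<open>b_KK_eta\<close>, and \<open>\<nu> = \<Sum>\<^sub>k t\<^bsub>km\<^esub> (x\<^sub>1\<^sup>2 k)*\<close> in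
    lemma \<open>b_LK_kappa\<close>.
  \<^item> Anticommuting \<open>x\<^sub>i*\<close> past \<open>x\<^sub>j*\<close> turns the Koszul terms into
    \<open>- \<Sum>\<^sub>i x\<^sub>i \<otimes> \<eta>(x\<^sub>i*(\<theta>) \<otimes> m*)\<close>, and likewise for \<open>\<kappa>\<close>
    (lemma \<open>Kos_der\<close>).

  The values lie in the modules of the complex because the coefficients are polynomials in the
  variables of \<open>\<RR>\<close> and because \<open>\<eta> \<circ> \<eta> = 0\<close> and \<open>\<kappa> \<circ> \<kappa> = 0\<close>.
\<close>

section \<open>Linear maps of free modules\<close>

text \<open>The index \<open>1\<close> is distinguished throughout and should not be rewritten to \<open>Suc 0\<close>.\<close>

declare One_nat_def [simp del]

lemma lookup_smul: "Poly_Mapping.lookup (c \<cdot>\<^sub>s z) b = c * Poly_Mapping.lookup z b"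
  by (simp add: smul_def Poly_Mapping.map.rep_eq when_def)

interpretation smul: Modules.module "smul :: 'a::comm_ring_1 \<Rightarrow> ('b \<Rightarrow>\<^sub>0 'a) \<Rightarrow> _"
  by unfold_locales (auto intro!: poly_mapping_eqI simp: lookup_smul lookup_add algebra_simps)

text \<open>Linearity of a map between free modules over the same ring.\<close>

abbreviation lin :: "(('b \<Rightarrow>\<^sub>0 'a::comm_ring_1) \<Rightarrow> ('c \<Rightarrow>\<^sub>0 'a)) \<Rightarrow> bool" where
  "lin \<equiv> Modules.module_hom smul smul"

lemma linI:
  assumes "\<And>x y. f (x + y) = f x + f y" "\<And>c x. f (c \<cdot>\<^sub>s x) = c \<cdot>\<^sub>s f x"
  shows "lin f"
  by (intro Modules.module_hom.intro Modules.module_hom_axioms.intro assms smul.module_axioms)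

lemma poly_mapping_expand: "z = (\<Sum>b\<in>Poly_Mapping.keys z. Poly_Mapping.lookup z b \<cdot>\<^sub>s bvec b)"
  by (rule poly_mapping_eqI)
    (simp add: lookup_sum lookup_smul bvec_def lookup_single when_def in_keys_iff if_distrib
      cong: if_cong)

lemma linext_superset:
  assumes "finite A" "Poly_Mapping.keys z \<subseteq> A"
  shows "linext f z = (\<Sum>b\<in>A. Poly_Mapping.lookup z b \<cdot>\<^sub>s f b)"
  unfolding linext_def using assms
  by (intro sum.mono_neutral_left) (auto simp: in_keys_iff)

lemma lin_linext: "lin (linext f)"
proof (rule linI)
  fix x y :: "'b \<Rightarrow>\<^sub>0 'a"
  let ?A = "Poly_Mapping.keys x \<union> Poly_Mapping.keys y"
  have "Poly_Mapping.keys (x + y) \<subseteq> ?A" by (rule Poly_Mapping.keys_add)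
  then show "linext f (x + y) = linext f x + linext f y"
    by (simp add: linext_superset[of ?A] lookup_add smul.scale_left_distrib sum.distrib)
next
  fix c and x :: "'b \<Rightarrow>\<^sub>0 'a"
  have "Poly_Mapping.keys (c \<cdot>\<^sub>s x) \<subseteq> Poly_Mapping.keys x"
    by (auto simp: in_keys_iff lookup_smul)
  then show "linext f (c \<cdot>\<^sub>s x) = c \<cdot>\<^sub>s linext f x"
    by (simp add: linext_superset[of "Poly_Mapping.keys x"] lookup_smul smul.scale_sum_right)
qed

lemma linext_bvec [simp]: "linext f (bvec b) = f b"
  by (simp add: linext_superset[of "{b}"] bvec_def)

text \<open>Most identities below hold because both sides are linear and agree on the basis.\<close>

lemma lin_eqI:
  assumes "lin f" "lin g" "\<And>b. f (bvec b) = g (bvec b)"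
  shows "f z = g z"
proof -
  have "f z = f (\<Sum>b\<in>Poly_Mapping.keys z. Poly_Mapping.lookup z b \<cdot>\<^sub>s bvec b)"
    using poly_mapping_expand[of z] by simp
  also have "\<dots> = g (\<Sum>b\<in>Poly_Mapping.keys z. Poly_Mapping.lookup z b \<cdot>\<^sub>s bvec b)"
    by (simp add: Modules.module_hom.sum[OF assms(1)] Modules.module_hom.sum[OF assms(2)]
        Modules.module_hom.scale[OF assms(1)] Modules.module_hom.scale[OF assms(2)] assms(3))
  also have "\<dots> = g z" using poly_mapping_expand[of z] by simp
  finally show ?thesis .
qed

lemma lin_compose:
  assumes "lin f" "lin g"
  shows "lin (\<lambda>z. f (g z))"
  by (rule linI) (simp_all add: assms[THEN Modules.module_hom.add] assms[THEN Modules.module_hom.scale])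

lemma lin_add:
  assumes "lin f" "lin g"
  shows "lin (\<lambda>z. f z + g z)"
  by (rule linI) (simp_all add: assms[THEN Modules.module_hom.add]
      assms[THEN Modules.module_hom.scale] smul.scale_right_distrib)

lemma lin_minus:
  assumes "lin f"
  shows "lin (\<lambda>z. - f z)"
  by (rule linI) (simp_all add: assms[THEN Modules.module_hom.add]
      assms[THEN Modules.module_hom.scale])

lemma lin_smul:
  assumes "lin f"
  shows "lin (\<lambda>z. c \<cdot>\<^sub>s f z)"
  by (rule linI) (simp_all add: assms[THEN Modules.module_hom.add]
      assms[THEN Modules.module_hom.scale] smul.scale_right_distrib mult.commute)

lemma lin_sum:
  assumes "\<And>i. lin (f i)"
  shows "lin (\<lambda>z. \<Sum>i\<in>A. f i z)"
  by (rule linI) (simp_all add: assms[THEN Modules.module_hom.add]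
      assms[THEN Modules.module_hom.scale] sum.distrib smul.scale_sum_right)

lemma lin_id: "lin (\<lambda>z. z)" by (rule linI) simp_all

lemma lin_zero: "lin (\<lambda>z. 0)" by (rule linI) simp_all

lemma lookup_tensor:
  "Poly_Mapping.lookup (u \<otimes>\<^sub>t v) (b, c) = Poly_Mapping.lookup u b * Poly_Mapping.lookup v c"
proof -
  have "Poly_Mapping.lookup (u \<otimes>\<^sub>t v) (b, c) =
    (\<Sum>b'\<in>Poly_Mapping.keys u. \<Sum>c'\<in>Poly_Mapping.keys v.
      if b' = b then if c' = c then Poly_Mapping.lookup u b * Poly_Mapping.lookup v c else 0 else 0)"
    unfolding tensor_def lookup_sum by (intro sum.cong refl) (auto simp: lookup_single)
  also have "\<dots> = (\<Sum>b'\<in>Poly_Mapping.keys u. if b' = b then \<Sum>c'\<in>Poly_Mapping.keys v.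
      if c' = c then Poly_Mapping.lookup u b * Poly_Mapping.lookup v c else 0 else 0)"
    by (intro sum.cong refl) auto
  also have "\<dots> = Poly_Mapping.lookup u b * Poly_Mapping.lookup v c"
    by (auto simp: in_keys_iff)
  finally show ?thesis .
qed

lemma lin_tensor_left: "lin (\<lambda>u. u \<otimes>\<^sub>t v)"
  and lin_tensor_right: "lin (\<lambda>v. u \<otimes>\<^sub>t v)"
  by (rule linI; rule poly_mapping_eqI; clarsimp simp: lookup_tensor lookup_add lookup_smul algebra_simps)+

lemma tensor_bvec: "bvec b \<otimes>\<^sub>t bvec c = bvec (b, c)"
  by (rule poly_mapping_eqI) (auto simp: lookup_tensor bvec_def lookup_single when_def split: if_splits)

lemma keys_tensor: "Poly_Mapping.keys (u \<otimes>\<^sub>t v) \<subseteq> Poly_Mapping.keys u \<times> Poly_Mapping.keys v"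
  by (auto simp: in_keys_iff lookup_tensor)

section \<open>The maps eta and kappa\<close>

lemma lin_der: "lin (der i)" by (simp add: der_def lin_linext)
lemma lin_kappa: "lin (kappa d)" by (simp add: kappa_def lin_linext)
lemma lin_eta: "lin (eta d)" by (simp add: eta_def lin_linext)
lemma lin_contr_left: "lin (\<lambda>\<mu>. contr \<mu> \<nu>)" unfolding contr_def by (rule lin_linext)
lemma lin_contr_right: "lin (\<lambda>\<nu>. contr \<mu> \<nu>)"
  unfolding contr_def linext_def[of _ \<mu>] by (intro lin_sum lin_smul lin_linext)
lemma lin_q: "lin (q d n)" by (simp add: q_def lin_linext)
lemma lin_proj0: "lin proj0" by (simp add: proj0_def lin_linext)
lemma lin_Kos: "lin (Kos d)" unfolding Kos_def[abs_def] by (intro lin_sum lin_smul lin_der)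

lemma contr_bvec: "contr (bvec m) (bvec k) = of_bool (mdvd m k) \<cdot>\<^sub>s bvec (k - m)"
  by (simp add: contr_def)

lemmas lin_intros = lin_id lin_zero lin_add lin_minus lin_smul lin_sum
  lin_compose[OF lin_der] lin_compose[OF lin_eta] lin_compose[OF lin_kappa]
  lin_compose[OF lin_tensor_left] lin_compose[OF lin_tensor_right]
  lin_compose[OF lin_contr_left] lin_compose[OF lin_contr_right]
  lin_compose[OF lin_q] lin_compose[OF lin_proj0] lin_compose[OF lin_Kos]

lemma der_smul: "der i (c \<cdot>\<^sub>s x) = c \<cdot>\<^sub>s der i x"
  and der_zero: "der i 0 = 0"
  and der_uminus: "der i (- x) = - der i x"
  using lin_der[of i, THEN Modules.module_hom.scale]
    lin_der[of i, THEN Modules.module_hom.zero] lin_der[of i, THEN Modules.module_hom.neg] by auto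

lemma eta_tensor: "eta d (\<theta> \<otimes>\<^sub>t \<nu>) = (\<Sum>i=1..d. der i \<theta> \<otimes>\<^sub>t contr (bvec (xm i)) \<nu>)"
proof (rule lin_eqI[of "\<lambda>\<theta>. eta d (\<theta> \<otimes>\<^sub>t \<nu>)"])
  show "eta d (bvec S \<otimes>\<^sub>t \<nu>) = (\<Sum>i=1..d. der i (bvec S) \<otimes>\<^sub>t contr (bvec (xm i)) \<nu>)" for S
    by (rule lin_eqI[of "\<lambda>\<nu>. eta d (bvec S \<otimes>\<^sub>t \<nu>)"])
      (intro lin_intros | simp add: tensor_bvec eta_def)+
qed (intro lin_intros)+

lemma kappa_tensor: "kappa d (\<theta> \<otimes>\<^sub>t bvec m) = (\<Sum>i=1..d. der i \<theta> \<otimes>\<^sub>t bvec (xm i + m))"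
proof (rule lin_eqI[of "\<lambda>\<theta>. kappa d (\<theta> \<otimes>\<^sub>t bvec m)"])
  have "(bvec a :: mon \<Rightarrow>\<^sub>0 'a) * bvec b = bvec (a + b)" for a b
    by (simp add: bvec_def mult_single)
  then show "kappa d (bvec S \<otimes>\<^sub>t bvec m) = (\<Sum>i=1..d. der i (bvec S :: _ \<Rightarrow>\<^sub>0 'a) \<otimes>\<^sub>t bvec (xm i + m))" for S
    by (simp add: tensor_bvec kappa_def)
qed (intro lin_intros)+

lemma der_bvec: "der i (bvec S) = (if i \<in> S then (- 1) ^ card {j \<in> S. j < i} \<cdot>\<^sub>s bvec (S - {i}) else 0)"
  by (simp add: der_def)

lemma der_der_same: "der i (der i \<theta>) = 0"
  by (rule lin_eqI[of "\<lambda>\<theta>. der i (der i \<theta>)"])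
    (intro lin_intros | simp add: der_bvec der_smul der_zero)+

text \<open>
  For \<open>j < i\<close> in \<open>S\<close>, removing \<open>j\<close> from \<open>S\<close> lowers the position of \<open>i\<close> by one,
  while removing \<open>i\<close> does not affect the position of \<open>j\<close>.
\<close>

lemma der_anticommute: "der i (der j \<theta>) = - der j (der i \<theta>)"
proof (cases "i = j")
  case False
  have *: "der i (der j (bvec S)) = - der j (der i (bvec S :: _ \<Rightarrow>\<^sub>0 'a))" if "j < i" for i j S
  proof (cases "i \<in> S \<and> j \<in> S")
    case True
    then have 1: "{k \<in> S - {i}. k < j} = {k \<in> S. k < j}" using that by auto
    have "finite {k \<in> S - {j}. k < i}" by simp
    moreover have "{k \<in> S. k < i} = insert j {k \<in> S - {j}. k < i}" using that True by auto
    ultimately have 2: "card {k \<in> S. k < i} = Suc (card {k \<in> S - {j}. k < i})" by simp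
    have "S - {i} - {j} = S - {j} - {i}" by auto
    then show ?thesis using True that
      by (simp add: der_bvec der_smul der_uminus 1[simplified] 2 mult.commute)
  next
    case False
    with that show ?thesis by (auto simp: der_bvec der_smul der_zero)
  qed
  have "der i (der j (bvec S)) = - der j (der i (bvec S :: _ \<Rightarrow>\<^sub>0 'a))" for S
  proof (cases "j < i")
    case True
    then show ?thesis by (rule *)
  next
    case False
    then have "i < j" using \<open>i \<noteq> j\<close> by simp
    then show ?thesis by (subst *[of i j]) simp_all
  qed
  then show ?thesis
    by (rule lin_eqI[of "\<lambda>\<theta>. der i (der j \<theta>)" "\<lambda>\<theta>. - der j (der i \<theta>)", rotated 2])
      (intro lin_intros)+
qed (simp add: der_der_same)

text \<open>The diagonal has to be assumed zero separately, since \<open>2\<close> may be a zero divisor.\<close>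

lemma sum_alternating_zero:
  fixes A :: "'i \<Rightarrow> 'i \<Rightarrow> 'a::ab_group_add"
  assumes "finite I" "\<And>i. A i i = 0" "\<And>i j. A i j = - A j i"
  shows "(\<Sum>i\<in>I. \<Sum>j\<in>I. A i j) = 0"
  using assms(1)
proof (induction I rule: finite_induct)
  case (insert a I)
  have "(\<Sum>i\<in>I. A i a) = - (\<Sum>j\<in>I. A a j)"
    unfolding sum_negf[symmetric] by (rule sum.cong) (rule refl, rule assms(3))
  with insert show ?case by (simp add: sum.distrib assms(2))
qed simp

lemma sum_der_der_zero:
  assumes "finite I" "\<And>i j. \<sigma> i j = \<sigma> j i"
  shows "(\<Sum>i\<in>I. \<Sum>j\<in>I. der i (der j \<theta>) \<otimes>\<^sub>t \<sigma> i j) = 0"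
proof (rule sum_alternating_zero[OF assms(1)])
  fix i j
  show "der i (der i \<theta>) \<otimes>\<^sub>t \<sigma> i i = 0"
    by (simp add: der_der_same Modules.module_hom.zero[OF lin_tensor_left])
  show "der i (der j \<theta>) \<otimes>\<^sub>t \<sigma> i j = - (der j (der i \<theta>) \<otimes>\<^sub>t \<sigma> j i)"
    by (subst der_anticommute)
      (simp add: Modules.module_hom.neg[OF lin_tensor_left] assms(2)[of i j])
qed

lemma mdvd_iff: "mdvd m k \<longleftrightarrow> (\<forall>i. Poly_Mapping.lookup m i \<le> Poly_Mapping.lookup k i)"
proof
  assume *: "\<forall>i. Poly_Mapping.lookup m i \<le> Poly_Mapping.lookup k i"
  have "k = m + (k - m)" by (rule poly_mapping_eqI) (use * in \<open>simp add: lookup_add lookup_minus\<close>)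
  then show "mdvd m k" unfolding mdvd_def ..
qed (auto simp: mdvd_def lookup_add)

lemma contr_bvec_bvec:
  "contr (bvec a) (contr (bvec b) \<nu>) = contr (bvec (a + b)) \<nu>"
proof -
  have "contr (bvec a) (contr (bvec b) (bvec m)) = contr (bvec (a + b)) (bvec m :: _ \<Rightarrow>\<^sub>0 'a)" for m
  proof -
    have "mdvd b m \<and> mdvd a (m - b) \<longleftrightarrow> mdvd (a + b) m"
      unfolding mdvd_iff lookup_add lookup_minus all_conj_distrib[symmetric]
      by (rule arg_cong[of _ _ All], rule ext) linarith
    moreover have "m - b - a = m - (a + b)"
      by (rule poly_mapping_eqI) (simp add: lookup_add lookup_minus)
    ultimately show ?thesis
      by (auto simp: contr_bvec Modules.module_hom.scale[OF lin_contr_right])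
  qed
  then show ?thesis
    by (rule lin_eqI[of "\<lambda>\<nu>. contr (bvec a) (contr (bvec b) \<nu>)" "\<lambda>\<nu>. contr (bvec (a + b)) \<nu>",
          rotated 2]) (intro lin_intros)+
qed

lemma eta_eta: "eta d (eta d z) = 0"
proof (rule lin_eqI[of "\<lambda>z. eta d (eta d z)"])
  fix b :: "nat set \<times> mon"
  obtain S m where b: "b = (S, m)" by force
  have "eta d (eta d (bvec S \<otimes>\<^sub>t bvec m)) = (\<Sum>j=1..d. \<Sum>i=1..d.
    der i (der j (bvec S)) \<otimes>\<^sub>t contr (bvec (xm i)) (contr (bvec (xm j)) (bvec m)) :: _ \<Rightarrow>\<^sub>0 'a)"
    by (simp only: eta_tensor Modules.module_hom.sum[OF lin_eta])
  also have "\<dots> = (\<Sum>i=1..d. \<Sum>j=1..d.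
    der i (der j (bvec S)) \<otimes>\<^sub>t contr (bvec (xm i + xm j)) (bvec m))"
    by (subst sum.swap) (simp only: contr_bvec_bvec)
  also have "\<dots> = 0" by (rule sum_der_der_zero) (simp_all add: add.commute)
  finally show "eta d (eta d (bvec b :: _ \<Rightarrow>\<^sub>0 'a)) = 0" by (simp only: b tensor_bvec)
qed (intro lin_intros)+

lemma kappa_kappa: "kappa d (kappa d z) = 0"
proof (rule lin_eqI[of "\<lambda>z. kappa d (kappa d z)"])
  fix b :: "nat set \<times> mon"
  obtain S m where b: "b = (S, m)" by force
  have "kappa d (kappa d (bvec S \<otimes>\<^sub>t bvec m)) = (\<Sum>j=1..d. \<Sum>i=1..d.
    der i (der j (bvec S)) \<otimes>\<^sub>t bvec (xm i + (xm j + m)) :: _ \<Rightarrow>\<^sub>0 'a)"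
    by (simp only: kappa_tensor Modules.module_hom.sum[OF lin_kappa])
  also have "\<dots> = (\<Sum>i=1..d. \<Sum>j=1..d.
    der i (der j (bvec S)) \<otimes>\<^sub>t bvec (xm i + xm j + m))"
    by (subst sum.swap) (simp only: add.assoc)
  also have "\<dots> = 0" by (rule sum_der_der_zero) (simp_all add: ac_simps)
  finally show "kappa d (kappa d (bvec b :: _ \<Rightarrow>\<^sub>0 'a)) = 0" by (simp only: b tensor_bvec)
qed (intro lin_intros)+

section \<open>Base change from the integers\<close>

lemma lookup_bc: "Poly_Mapping.lookup (bc z) b = of_int (Poly_Mapping.lookup z b)"
  by (simp add: bc_def Poly_Mapping.map.rep_eq when_def)

lemma bc_add: "bc (x + y) = bc x + bc y"
  by (rule poly_mapping_eqI) (simp add: lookup_bc lookup_add)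

lemma bc_smul: "bc (c \<cdot>\<^sub>s x) = of_int c \<cdot>\<^sub>s bc x"
  by (rule poly_mapping_eqI) (simp add: lookup_bc lookup_smul)

lemma bc_zero [simp]: "bc 0 = 0"
  by (rule poly_mapping_eqI) (simp add: lookup_bc)

lemma bc_sum: "bc (\<Sum>i\<in>I. f i) = (\<Sum>i\<in>I. bc (f i))"
  by (induction I rule: infinite_finite_induct) (simp_all add: bc_add)

lemma bc_bvec [simp]: "bc (bvec b) = bvec b"
  by (rule poly_mapping_eqI)
    (simp add: lookup_bc bvec_def when_def lookup_single)

lemma bc_tensor: "bc (u \<otimes>\<^sub>t v) = bc u \<otimes>\<^sub>t bc v"
proof (rule poly_mapping_eqI)
  fix k
  show "Poly_Mapping.lookup (bc (u \<otimes>\<^sub>t v)) k = Poly_Mapping.lookup (bc u \<otimes>\<^sub>t bc v) k"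
    by (cases k) (simp add: lookup_bc lookup_tensor)
qed

lemma bc_linear_commute:
  assumes f: "lin f" and g: "lin g" and fg: "\<And>b. bc (f (bvec b)) = g (bvec b)"
  shows "bc (f z) = g (bc z)"
proof -
  let ?z = "\<Sum>b\<in>Poly_Mapping.keys z. Poly_Mapping.lookup z b \<cdot>\<^sub>s bvec b"
  have "bc (f ?z) = g (bc ?z)"
    by (simp add: bc_sum bc_smul fg Modules.module_hom.sum[OF f] Modules.module_hom.scale[OF f]
        Modules.module_hom.sum[OF g] Modules.module_hom.scale[OF g])
  then show ?thesis using poly_mapping_expand[of z] by simp
qed

lemma bc_der: "bc (der i z) = der i (bc z)"
  by (rule bc_linear_commute[OF lin_der lin_der]) (simp add: der_bvec bc_smul)

lemma bc_eta: "bc (eta d z) = eta d (bc z)"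
proof (rule bc_linear_commute[OF lin_eta lin_eta])
  fix b :: "nat set \<times> mon"
  obtain S m where b: "b = (S, m)" by force
  show "bc (eta d (bvec b)) = eta d (bvec b)"
    unfolding b tensor_bvec[symmetric] eta_tensor
    by (simp add: bc_sum bc_tensor bc_der contr_bvec bc_smul)
qed

lemma bc_kappa: "bc (kappa d z) = kappa d (bc z)"
proof (rule bc_linear_commute[OF lin_kappa lin_kappa])
  fix b :: "nat set \<times> mon"
  obtain S m where b: "b = (S, m)" by force
  show "bc (kappa d (bvec b)) = kappa d (bvec b)"
    unfolding b tensor_bvec[symmetric] kappa_tensor
    by (simp add: bc_sum bc_tensor bc_der)
qed

section \<open>Sums over monomials\<close>

lemma mdeg_superset:
  assumes "finite A" "Poly_Mapping.keys m \<subseteq> A"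
  shows "mdeg m = (\<Sum>i\<in>A. Poly_Mapping.lookup m i)"
  unfolding mdeg_def using assms by (intro sum.mono_neutral_left) (auto simp: in_keys_iff)

lemma mdeg_add: "mdeg (a + b) = mdeg a + mdeg b"
proof -
  let ?A = "Poly_Mapping.keys a \<union> Poly_Mapping.keys b"
  have "Poly_Mapping.keys (a + b) \<subseteq> ?A" by (rule Poly_Mapping.keys_add)
  then show ?thesis by (simp add: mdeg_superset[of ?A] lookup_add sum.distrib)
qed

lemma keys_mon_add:
  "Poly_Mapping.keys (a + b :: mon) = Poly_Mapping.keys a \<union> Poly_Mapping.keys b"
  by (auto simp: in_keys_iff lookup_add)

lemma mdvd_add_diff: "mdvd a k \<Longrightarrow> a + (k - a) = k"
  by (auto simp: mdvd_def)

lemma mon_add_cancel: "m + (a + l) - a = m + (l :: mon)"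
  by (metis add.left_commute add_diff_cancel_left')

lemma mdvd_add [simp]: "mdvd a (a + b)" by (auto simp: mdvd_def)

lemma mons_add: "a \<in> mons i d s \<Longrightarrow> b \<in> mons i d t \<Longrightarrow> a + b \<in> mons i d (s + t)"
  by (auto simp: mons_def mdeg_add keys_mon_add)

lemma mons_diff:
  assumes "k \<in> mons i d (s + t)" "a \<in> mons j e t" "mdvd a k"
  shows "k - a \<in> mons i d s"
proof -
  obtain l where l: "k = a + l" using assms(3) unfolding mdvd_def by blast
  with assms(1,2) show ?thesis by (auto simp: mons_def mdeg_add keys_mon_add)
qed

lemma finite_mons [simp]: "finite (mons i d s)"
proof (rule inj_on_finite)
  show "inj_on (\<lambda>m. restrict (Poly_Mapping.lookup m) {i..d}) (mons i d s)"
  proof (rule inj_onI, rule poly_mapping_eqI)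
    fix m m' k
    assume m: "m \<in> mons i d s" "m' \<in> mons i d s"
      and eq: "restrict (Poly_Mapping.lookup m) {i..d} = restrict (Poly_Mapping.lookup m') {i..d}"
    show "Poly_Mapping.lookup m k = Poly_Mapping.lookup m' k"
    proof (cases "k \<in> {i..d}")
      case True
      then show ?thesis using fun_cong[OF eq, of k] by simp
    next
      case False
      then have "k \<notin> Poly_Mapping.keys m" "k \<notin> Poly_Mapping.keys m'" using m by (auto simp: mons_def)
      then show ?thesis by (simp add: in_keys_iff)
    qed
  qed
  have "Poly_Mapping.lookup m k \<le> s" if "m \<in> mons i d s" for m k
  proof (cases "k \<in> Poly_Mapping.keys m")
    case True
    then have "Poly_Mapping.lookup m k \<le> mdeg m"
      unfolding mdeg_def by (intro member_le_sum) auto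
    then show ?thesis using that by (simp add: mons_def)
  qed (simp add: in_keys_iff)
  then show "(\<lambda>m. restrict (Poly_Mapping.lookup m) {i..d}) ` mons i d s \<subseteq> {i..d} \<rightarrow>\<^sub>E {..s}"
    by (auto simp: PiE_def)
  show "finite ({i..d} \<rightarrow>\<^sub>E {..s})" by (intro finite_PiE) auto
qed

lemma xm_mons: "i \<le> j \<Longrightarrow> j \<le> d \<Longrightarrow> xm j \<in> mons i d 1"
  by (simp add: mons_def xm_def mdeg_def)

lemma lookup_xm: "Poly_Mapping.lookup (xm i) j = of_bool (i = j)"
  by (simp add: xm_def lookup_single)

lemma mdvd_xm: "mdvd (xm i) m \<longleftrightarrow> Poly_Mapping.lookup m i \<noteq> 0"
  by (auto simp: mdvd_iff lookup_xm)

lemma mons2_subset: "mons 2 d s \<subseteq> mons 1 d s"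
  by (auto simp: mons_def)

lemma mons2_iff: "m \<in> mons 2 d s \<longleftrightarrow> m \<in> mons 1 d s \<and> \<not> mdvd (xm 1) m"
proof -
  have "Poly_Mapping.keys m \<subseteq> {2..d} \<longleftrightarrow> Poly_Mapping.keys m \<subseteq> {1..d} \<and> 1 \<notin> Poly_Mapping.keys m"
    by (auto simp: subset_iff) (metis One_nat_def Suc_1 le_antisym not_less_eq_eq)
  then show ?thesis by (auto simp: mons_def mdvd_xm in_keys_iff)
qed

text \<open>The multiples of \<open>a\<close> of degree \<open>s + t\<close> are the products of \<open>a\<close> with the monomials of degree \<open>s\<close>.\<close>

lemma sum_mons_multiples:
  fixes f :: "mon \<Rightarrow> 'b::comm_monoid_add"
  assumes "a \<in> mons i d t"
  shows "(\<Sum>k\<in>mons i d (s + t). if mdvd a k then f k else 0) = (\<Sum>l\<in>mons i d s. f (a + l))"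
proof -
  have "(\<Sum>k\<in>mons i d (s + t). if mdvd a k then f k else 0) =
      (\<Sum>k\<in>{k \<in> mons i d (s + t). mdvd a k}. f k)"
    by (intro sum.mono_neutral_cong_right) auto
  also have "\<dots> = (\<Sum>l\<in>mons i d s. f (a + l))"
    by (rule sum.reindex_bij_witness[of _ "\<lambda>l. a + l" "\<lambda>k. k - a"])
      (use assms in \<open>auto simp: mdvd_add_diff add.commute[of s] intro: mons_add mons_diff\<close>)
  finally show ?thesis .
qed

text \<open>Monomials of positive degree are split according to whether \<open>x\<^sub>1\<close> divides them.\<close>

lemma sum_mons_split:
  fixes f :: "mon \<Rightarrow> 'b::comm_monoid_add"
  assumes "1 \<le> d"
  shows "(\<Sum>k\<in>mons 1 d (Suc s). f k) = (\<Sum>k\<in>mons 2 d (Suc s). f k) + (\<Sum>l\<in>mons 1 d s. f (xm 1 + l))"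
proof -
  have "(\<Sum>k\<in>mons 1 d (Suc s). f k) = (\<Sum>k\<in>mons 1 d (Suc s). if mdvd (xm 1) k then 0 else f k) +
      (\<Sum>k\<in>mons 1 d (s + 1). if mdvd (xm 1) k then f k else 0)"
    unfolding Suc_eq_plus1 sum.distrib[symmetric] by (rule sum.cong) auto
  also have "(\<Sum>k\<in>mons 1 d (Suc s). if mdvd (xm 1) k then 0 else f k) = (\<Sum>k\<in>mons 2 d (Suc s). f k)"
    by (intro sum.mono_neutral_cong_right) (auto simp: mons2_iff)
  finally show ?thesis
    using sum_mons_multiples[OF xm_mons[of 1 1 d], where s = s and f = f] assms by simp
qed

section \<open>The classical adjoint and contractions of Phi tilde\<close>

lemma mon_list: "set (mon_list d n) = mons 1 d (n - 1)" "distinct (mon_list d n)"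
  by (simp_all add: mon_list_def)

lemma mon_pos:
  assumes "m \<in> mons 1 d (n - 1)"
  shows "mon_pos d n m < length (mon_list d n)" "mon_list d n ! mon_pos d n m = m"
proof -
  have "m \<in> (!) (mon_list d n) ` {..<length (mon_list d n)}"
    using assms unfolding mon_list(1)[of d n, symmetric] by (auto simp: in_set_conv_nth)
  from inv_into_into[OF this] f_inv_into_f[OF this]
  show "mon_pos d n m < length (mon_list d n)" "mon_list d n ! mon_pos d n m = m"
    by (auto simp: mon_pos_def)
qed

lemma mon_pos_nth: "i < length (mon_list d n) \<Longrightarrow> mon_pos d n (mon_list d n ! i) = i"
  unfolding mon_pos_def
  by (rule inv_into_f_f) (auto simp: mon_list(2) inj_on_nth)

lemma sum_mon_list: "(\<Sum>m\<in>mons 1 d (n - 1). f m) = (\<Sum>i<length (mon_list d n). f (mon_list d n ! i))"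
  by (rule sum.reindex_bij_witness[of _ "(!) (mon_list d n)" "mon_pos d n"])
    (auto simp: mon_pos mon_pos_nth mon_list(1)[symmetric] simp del: set_sorted_list_of_set)

lemma Tmat_carrier: "Tmat d n \<in> carrier_mat (length (mon_list d n)) (length (mon_list d n))"
  by (simp add: Tmat_def)

lemma Tmat_index:
  assumes "k \<in> mons 1 d (n - 1)" "i < length (mon_list d n)"
  shows "Tmat d n $$ (mon_pos d n k, i) = rt (k + mon_list d n ! i)"
  using assms by (simp add: Tmat_def mon_pos)

lemma T_times_Q:
  assumes k: "k \<in> mons 1 d (n - 1)" and m: "m \<in> mons 1 d (n - 1)"
  shows "(\<Sum>m1\<in>mons 1 d (n - 1). Q d n m1 m * rt (k + m1)) = (if k = m then delta d n else 0)"
proof -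
  let ?N = "length (mon_list d n)" and ?p = "mon_pos d n"
  note A = adj_mat[OF Tmat_carrier[of d n]]
  have eq: "?p k = ?p m \<longleftrightarrow> k = m" using mon_pos(2)[OF k] mon_pos(2)[OF m] by metis
  have "(\<Sum>m1\<in>mons 1 d (n - 1). Q d n m1 m * rt (k + m1)) =
      (\<Sum>i<?N. Tmat d n $$ (?p k, i) * adj_mat (Tmat d n) $$ (i, ?p m))"
    unfolding sum_mon_list
    by (rule sum.cong) (simp_all add: Q_def mon_pos k mon_pos_nth mult.commute Tmat_index)
  also have "\<dots> = (Tmat d n * adj_mat (Tmat d n)) $$ (?p k, ?p m)"
    using A(1) Tmat_carrier[of d n] mon_pos(1)[OF k] mon_pos(1)[OF m]
    by (auto simp: scalar_prod_def atLeast0LessThan)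
  also have "\<dots> = (if k = m then delta d n else 0)"
    unfolding A(2) delta_def using mon_pos(1)[OF k] mon_pos(1)[OF m] eq by simp
  finally show ?thesis .
qed

text \<open>
  The coefficient of \<open>l*\<close> in \<open>m(\<Phi>~)\<close> is that of \<open>(m l)*\<close> in \<open>\<Phi>~\<close>, namely
  \<open>t\<close> indexed by \<open>m l / x\<^sub>1\<close> if \<open>x\<^sub>1\<close> divides \<open>m l\<close>, and zero otherwise.
\<close>

lemma contr_Phi_tilde:
  assumes d: "1 \<le> d" and m: "m \<in> mons 1 d t" and st: "s + t = Suc (2 * n - 2)"
  shows "contr (bvec m) (Phi_tilde d n) =
    (\<Sum>l\<in>mons 1 d s. (if mdvd (xm 1) (m + l) then rt (m + l - xm 1) else 0) \<cdot>\<^sub>s bvec l)"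
proof -
  have "contr (bvec m) (Phi_tilde d n) =
      (\<Sum>k\<in>mons 1 d (2 * n - 2). (\<lambda>l. if mdvd m l then rt (l - xm 1) \<cdot>\<^sub>s bvec (l - m) else 0) (xm 1 + k))"
    unfolding Phi_tilde_def Modules.module_hom.sum[OF lin_contr_right]
    by (intro sum.cong refl) (simp add: Modules.module_hom.scale[OF lin_contr_right] contr_bvec)
  also have "\<dots> = (\<Sum>l\<in>mons 1 d (2 * n - 2 + 1). if mdvd (xm 1) l then
      if mdvd m l then rt (l - xm 1) \<cdot>\<^sub>s bvec (l - m) else 0 else 0)"
    by (rule sum_mons_multiples[symmetric]) (use d in \<open>simp add: xm_mons\<close>)
  also have "\<dots> = (\<Sum>l\<in>mons 1 d (s + t). if mdvd m l then
      if mdvd (xm 1) l then rt (l - xm 1) \<cdot>\<^sub>s bvec (l - m) else 0 else 0)"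
    using st by (intro sum.cong) (auto simp flip: Suc_eq_plus1)
  also have "\<dots> = (\<Sum>l\<in>mons 1 d s. (if mdvd (xm 1) (m + l) then rt (m + l - xm 1) else 0) \<cdot>\<^sub>s bvec l)"
    unfolding sum_mons_multiples[OF m] by (rule sum.cong) auto
  finally show ?thesis .
qed

lemma mdvd_xm_add: "mdvd (xm i) (m + l) \<longleftrightarrow> mdvd (xm i) m \<or> mdvd (xm i) l"
  by (simp add: mdvd_xm lookup_add)

lemma contr_Phi_tilde_mons2:
  assumes d: "1 \<le> d" and n: "2 \<le> n" and m: "m \<in> mons 2 d n"
  shows "contr (bvec m) (Phi_tilde d n) = (\<Sum>m1\<in>mons 1 d (n - 2). rt (m1 + m) \<cdot>\<^sub>s bvec (xm 1 + m1))"
proof -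
  have m': "m \<in> mons 1 d n" "\<not> mdvd (xm 1) m" using m by (auto simp: mons2_iff)
  have "contr (bvec m) (Phi_tilde d n) = (\<Sum>l\<in>mons 1 d (n - 2 + 1).
      if mdvd (xm 1) l then rt (m + l - xm 1) \<cdot>\<^sub>s bvec l else 0)"
    using n by (subst contr_Phi_tilde[OF d m'(1), of "n - 2 + 1"])
      (auto intro!: sum.cong simp: mdvd_xm_add m'(2))
  also have "\<dots> = (\<Sum>m1\<in>mons 1 d (n - 2). rt (m1 + m) \<cdot>\<^sub>s bvec (xm 1 + m1))"
    by (subst sum_mons_multiples) (use d in \<open>auto simp: xm_mons mon_add_cancel add.commute[of _ m] intro!: sum.cong\<close>)
  finally show ?thesis .
qed

lemma q_bvec: "q d n (bvec m) = (\<Sum>m1\<in>mons 1 d (n - 1). Q d n m1 m \<cdot>\<^sub>s bvec m1)"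
  by (simp add: q_def)

text \<open>
  In \<open>[q(m*)](\<Phi>~)\<close>, the coefficient of \<open>(x\<^sub>1 k)*\<close> is
  \<open>\<Sum> t\<^bsub>k m1\<^esub> Q\<^bsub>m1, m\<^esub>\<close>, an entry of \<open>T\<close> times its classical adjoint; if
  \<open>x\<^sub>1\<close> does not divide \<open>m\<^sub>2\<close>, only the \<open>m\<^sub>1\<close> divisible by \<open>x\<^sub>1\<close> contribute to the
  coefficient of \<open>m\<^sub>2*\<close>.
\<close>

lemma contr_q_Phi_tilde:
  assumes d: "1 \<le> d" and n: "2 \<le> n" and m: "m \<in> mons 1 d (n - 1)"
  shows "contr (q d n (bvec m)) (Phi_tilde d n) =
    delta d n \<cdot>\<^sub>s bvec (xm 1 + m) +
    (\<Sum>m1\<in>mons 1 d (n - 2). \<Sum>m2\<in>mons 2 d n. (rt (m1 + m2) * Q d n (xm 1 + m1) m) \<cdot>\<^sub>s bvec m2)"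
proof -
  have n': "n - 1 = Suc (n - 2)" using n by simp
  \<comment> \<open>\<open>c m1 l\<close> is the coefficient of \<open>l*\<close> in \<open>m1(\<Phi>~)\<close>.\<close>
  define c where "c m1 l = (if mdvd (xm 1) (m1 + l) then rt (m1 + l - xm 1) else 0)" for m1 l
  have "contr (q d n (bvec m)) (Phi_tilde d n) =
      (\<Sum>m1\<in>mons 1 d (n - 1). Q d n m1 m \<cdot>\<^sub>s contr (bvec m1) (Phi_tilde d n))"
    by (simp add: q_bvec Modules.module_hom.sum[OF lin_contr_left]
        Modules.module_hom.scale[OF lin_contr_left])
  also have "\<dots> = (\<Sum>m1\<in>mons 1 d (n - 1). \<Sum>l\<in>mons 1 d n. (Q d n m1 m * c m1 l) \<cdot>\<^sub>s bvec l)"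
    using n by (intro sum.cong refl, subst contr_Phi_tilde[OF d, of _ "n - 1" n])
      (auto simp: smul.scale_sum_right c_def)
  also have "\<dots> = (\<Sum>l\<in>mons 1 d (Suc (n - 1)). (\<Sum>m1\<in>mons 1 d (n - 1). Q d n m1 m * c m1 l) \<cdot>\<^sub>s bvec l)"
    using n by (subst sum.swap) (simp add: smul.scale_sum_left)
  also have "\<dots> = (\<Sum>l\<in>mons 2 d n. (\<Sum>m1\<in>mons 1 d (n - 1). Q d n m1 m * c m1 l) \<cdot>\<^sub>s bvec l) +
     (\<Sum>k\<in>mons 1 d (n - 1). (\<Sum>m1\<in>mons 1 d (n - 1). Q d n m1 m * c m1 (xm 1 + k)) \<cdot>\<^sub>s bvec (xm 1 + k))"
    using n by (subst sum_mons_split[OF d]) simp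
  also have "(\<Sum>k\<in>mons 1 d (n - 1). (\<Sum>m1\<in>mons 1 d (n - 1). Q d n m1 m * c m1 (xm 1 + k)) \<cdot>\<^sub>s bvec (xm 1 + k)) =
      (\<Sum>k\<in>mons 1 d (n - 1). if k = m then delta d n \<cdot>\<^sub>s bvec (xm 1 + k) else 0)"
  proof (intro sum.cong refl)
    fix k assume k: "k \<in> mons 1 d (n - 1)"
    have "c m1 (xm 1 + k) = rt (k + m1)" for m1
      by (simp add: c_def mdvd_xm_add mon_add_cancel add.commute[of k])
    then show "(\<Sum>m1\<in>mons 1 d (n - 1). Q d n m1 m * c m1 (xm 1 + k)) \<cdot>\<^sub>s bvec (xm 1 + k) =
      (if k = m then delta d n \<cdot>\<^sub>s bvec (xm 1 + k) else 0)"
      using T_times_Q[OF k m] by simp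
  qed
  also have "\<dots> = delta d n \<cdot>\<^sub>s bvec (xm 1 + m)" using m by simp
  also have "(\<Sum>l\<in>mons 2 d n. (\<Sum>m1\<in>mons 1 d (n - 1). Q d n m1 m * c m1 l) \<cdot>\<^sub>s bvec l) =
    (\<Sum>l\<in>mons 2 d n. (\<Sum>m1\<in>mons 1 d (n - 2). Q d n (xm 1 + m1) m * rt (m1 + l)) \<cdot>\<^sub>s bvec l)"
  proof (rule sum.cong[OF refl], rule arg_cong[of _ _ "\<lambda>r. r \<cdot>\<^sub>s _"])
    fix l assume "l \<in> mons 2 d n"
    then have l: "\<not> mdvd (xm 1) l" by (simp add: mons2_iff)
    have "(\<Sum>m1\<in>mons 2 d (Suc (n - 2)). Q d n m1 m * c m1 l) = 0"
      by (rule sum.neutral) (simp add: mons2_iff c_def mdvd_xm_add l)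
    moreover have "c (xm 1 + m1) l = rt (m1 + l)" for m1
      by (simp add: c_def add.assoc)
    ultimately show "(\<Sum>m1\<in>mons 1 d (n - 1). Q d n m1 m * c m1 l) =
      (\<Sum>m1\<in>mons 1 d (n - 2). Q d n (xm 1 + m1) m * rt (m1 + l))"
      unfolding n' by (simp add: sum_mons_split[OF d])
  qed
  also have "\<dots> = (\<Sum>m1\<in>mons 1 d (n - 2). \<Sum>m2\<in>mons 2 d n. (rt (m1 + m2) * Q d n (xm 1 + m1) m) \<cdot>\<^sub>s bvec m2)"
    by (subst sum.swap) (simp add: smul.scale_sum_left mult.commute)
  finally show ?thesis by (simp add: add.commute)
qed

lemma proj0_q:
  "proj0 (q d n (bvec m)) = (\<Sum>m1\<in>mons 2 d (n - 1). Q d n m1 m \<cdot>\<^sub>s bvec m1)"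
proof -
  have "proj0 (q d n (bvec m)) =
      (\<Sum>m1\<in>mons 1 d (n - 1). Q d n m1 m \<cdot>\<^sub>s (if mdvd (xm 1) m1 then 0 else bvec m1))"
    by (simp add: q_bvec Modules.module_hom.sum[OF lin_proj0] Modules.module_hom.scale[OF lin_proj0])
      (simp add: proj0_def)
  also have "\<dots> = (\<Sum>m1\<in>mons 2 d (n - 1). Q d n m1 m \<cdot>\<^sub>s bvec m1)"
    by (intro sum.mono_neutral_cong_right) (auto simp: mons2_iff)
  finally show ?thesis .
qed

section \<open>Membership in the ring and the modules of the complex\<close>

lemma Rset_iff: "p \<in> Rset d n \<longleftrightarrow>
    (\<forall>e\<in>Poly_Mapping.keys p. Poly_Mapping.keys e \<subseteq> GX ` {1..d} \<union> GT ` mons 1 d (2 * n - 2))"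
  by (simp add: Rset_def)

lemma Rset_zero: "0 \<in> Rset d n"
  and Rset_one: "1 \<in> Rset d n"
  by (simp_all add: Rset_iff)

lemma Rset_add: "p \<in> Rset d n \<Longrightarrow> r \<in> Rset d n \<Longrightarrow> p + r \<in> Rset d n"
  using Poly_Mapping.keys_add[of p r] by (force simp: Rset_iff)

lemma Rset_uminus: "p \<in> Rset d n \<Longrightarrow> - p \<in> Rset d n"
  by (simp add: Rset_iff)

lemma Rset_diff: "p \<in> Rset d n \<Longrightarrow> r \<in> Rset d n \<Longrightarrow> p - r \<in> Rset d n"
  using Rset_add[of p d n "- r"] Rset_uminus by simp

lemma Rset_mult:
  assumes "p \<in> Rset d n" "r \<in> Rset d n"
  shows "p * r \<in> Rset d n"
  unfolding Rset_iff
proof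
  fix e assume "e \<in> Poly_Mapping.keys (p * r)"
  then obtain a b where "a \<in> Poly_Mapping.keys p" "b \<in> Poly_Mapping.keys r" "e = a + b"
    using keys_mult[of p r] by blast
  with assms Poly_Mapping.keys_add[of a b]
  show "Poly_Mapping.keys e \<subseteq> GX ` {1..d} \<union> GT ` mons 1 d (2 * n - 2)"
    unfolding Rset_iff by blast
qed

lemma Rset_sum: "(\<And>i. i \<in> A \<Longrightarrow> f i \<in> Rset d n) \<Longrightarrow> sum f A \<in> Rset d n"
  by (induction A rule: infinite_finite_induct) (auto intro: Rset_zero Rset_add)

lemma Rset_prod: "(\<And>i. i \<in> A \<Longrightarrow> f i \<in> Rset d n) \<Longrightarrow> prod f A \<in> Rset d n"
  by (induction A rule: infinite_finite_induct) (auto intro: Rset_one Rset_mult)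

lemma Rset_power: "p \<in> Rset d n \<Longrightarrow> p ^ k \<in> Rset d n"
  by (induction k) (auto intro: Rset_one Rset_mult)

lemma Rset_rx: "1 \<le> i \<Longrightarrow> i \<le> d \<Longrightarrow> rx i \<in> Rset d n"
  by (auto simp: Rset_iff rx_def rvar_def)

lemma Rset_rt: "m \<in> mons 1 d (2 * n - 2) \<Longrightarrow> rt m \<in> Rset d n"
  by (auto simp: Rset_iff rt_def rvar_def)

lemma Rset_rmon: "m \<in> mons 1 d s \<Longrightarrow> rmon m \<in> Rset d n"
  unfolding rmon_def by (intro Rset_prod Rset_power Rset_rx) (auto simp: mons_def)

lemma Rset_det:
  assumes A: "A \<in> carrier_mat N N" and R: "\<And>i j. i < N \<Longrightarrow> j < N \<Longrightarrow> A $$ (i, j) \<in> Rset d n"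
  shows "det A \<in> Rset d n"
  unfolding det_def'[OF A]
proof (intro Rset_sum Rset_mult Rset_prod)
  fix p assume p: "p \<in> {p. p permutes {0..<N}}"
  show "signof p \<in> Rset d n"
    using Rset_one Rset_uminus[OF Rset_one] by (cases p rule: sign_cases) simp_all
  fix i assume "i \<in> {0..<N}"
  with p show "A $$ (i, p i) \<in> Rset d n"
    by (intro R) (auto simp: permutes_in_image)
qed

lemma Rset_Tmat:
  assumes "i < length (mon_list d n)" "j < length (mon_list d n)"
  shows "Tmat d n $$ (i, j) \<in> Rset d n"
proof -
  have "mon_list d n ! i \<in> mons 1 d (n - 1)" "mon_list d n ! j \<in> mons 1 d (n - 1)"
    using assms nth_mem mon_list(1) by blast+
  from mons_add[OF this] show ?thesis
    using assms by (simp add: Tmat_def Rset_rt diff_mult_distrib2 flip: mult_2)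
qed

lemma Rset_delta: "delta d n \<in> Rset d n"
  unfolding delta_def by (rule Rset_det[OF Tmat_carrier Rset_Tmat])

lemma Rset_Q:
  assumes "m1 \<in> mons 1 d (n - 1)" "m2 \<in> mons 1 d (n - 1)"
  shows "Q d n m1 m2 \<in> Rset d n"
proof -
  let ?T = "Tmat d n" and ?N = "length (mon_list d n)"
  let ?i = "mon_pos d n m1" and ?j = "mon_pos d n m2"
  have dims: "dim_row ?T = ?N" "dim_col ?T = ?N" by (simp_all add: Tmat_def)
  note ij = mon_pos(1)[OF assms(1)] mon_pos(1)[OF assms(2)]
  have "mat_delete ?T ?j ?i \<in> carrier_mat (?N - 1) (?N - 1)"
    using mat_delete_carrier[OF Tmat_carrier] .
  then have "det (mat_delete ?T ?j ?i) \<in> Rset d n"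
    by (rule Rset_det) (auto simp: mat_delete_def dims intro!: Rset_Tmat)
  then show ?thesis
    using ij by (simp add: Q_def adj_mat_def dims cofactor_def)
      (intro Rset_mult Rset_power Rset_uminus Rset_one)
qed

lemma Rtensor_base: "z \<in> M \<Longrightarrow> c \<in> Rset d n \<Longrightarrow> c \<cdot>\<^sub>s bc z \<in> Rtensor d n M"
  unfolding Rtensor_def by (rule CollectI, rule exI[of _ "{z}"], rule exI[of _ "\<lambda>_. c"]) simp

lemma Rtensor_zero: "0 \<in> Rtensor d n M"
  unfolding Rtensor_def by (rule CollectI, rule exI[of _ "{}"]) simp

lemma Rtensor_add:
  assumes "u \<in> Rtensor d n M" "v \<in> Rtensor d n M"
  shows "u + v \<in> Rtensor d n M"
proof -
  obtain F c where F: "u = (\<Sum>z\<in>F. c z \<cdot>\<^sub>s bc z)" "finite F" "F \<subseteq> M" "\<forall>z\<in>F. c z \<in> Rset d n"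
    using assms(1) unfolding Rtensor_def by auto
  obtain G e where G: "v = (\<Sum>z\<in>G. e z \<cdot>\<^sub>s bc z)" "finite G" "G \<subseteq> M" "\<forall>z\<in>G. e z \<in> Rset d n"
    using assms(2) unfolding Rtensor_def by auto
  define h where "h z = (if z \<in> F then c z else 0) + (if z \<in> G then e z else 0)" for z
  have u: "u = (\<Sum>z\<in>F \<union> G. (if z \<in> F then c z else 0) \<cdot>\<^sub>s bc z)"
    unfolding F(1) using F G by (intro sum.mono_neutral_cong_left) auto
  have v: "v = (\<Sum>z\<in>F \<union> G. (if z \<in> G then e z else 0) \<cdot>\<^sub>s bc z)"
    unfolding G(1) using F G by (intro sum.mono_neutral_cong_left) auto
  have "u + v = (\<Sum>z\<in>F \<union> G. h z \<cdot>\<^sub>s bc z)"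
    unfolding u v by (simp add: h_def smul.scale_left_distrib sum.distrib)
  moreover have "\<forall>z\<in>F \<union> G. h z \<in> Rset d n"
    using F G by (auto simp: h_def intro: Rset_add)
  ultimately show ?thesis
    using F G unfolding Rtensor_def
    by (intro CollectI exI[of _ "F \<union> G"] exI[of _ h]) auto
qed

lemma Rtensor_smul:
  assumes "u \<in> Rtensor d n M" "a \<in> Rset d n"
  shows "a \<cdot>\<^sub>s u \<in> Rtensor d n M"
proof -
  obtain F c where F: "u = (\<Sum>z\<in>F. c z \<cdot>\<^sub>s bc z)" "finite F" "F \<subseteq> M" "\<forall>z\<in>F. c z \<in> Rset d n"
    using assms(1) unfolding Rtensor_def by auto
  then show ?thesis unfolding Rtensor_def
    by (intro CollectI exI[of _ F] exI[of _ "\<lambda>z. a * c z"])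
      (auto simp: smul.scale_sum_right intro: Rset_mult assms)
qed

lemma Rtensor_uminus: "u \<in> Rtensor d n M \<Longrightarrow> - u \<in> Rtensor d n M"
  using Rtensor_smul[of u d n M "- 1"] by (simp add: Rset_uminus Rset_one)

lemma Rtensor_diff: "u \<in> Rtensor d n M \<Longrightarrow> v \<in> Rtensor d n M \<Longrightarrow> u - v \<in> Rtensor d n M"
  using Rtensor_add[of u d n M "- v"] Rtensor_uminus[of v d n M] by simp

lemma Rtensor_sum: "(\<And>i. i \<in> A \<Longrightarrow> f i \<in> Rtensor d n M) \<Longrightarrow> sum f A \<in> Rtensor d n M"
  by (induction A rule: infinite_finite_induct) (auto intro: Rtensor_zero Rtensor_add)

lemma der_one_wedge0: "\<theta> \<in> wedge0 d a \<Longrightarrow> der 1 \<theta> = 0"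
  unfolding der_def linext_def by (rule sum.neutral) (force simp: wedge0_def)

lemma der_wedge0:
  assumes "\<theta> \<in> wedge0 d a"
  shows "der i \<theta> \<in> wedge0 d (a - 1)"
proof -
  let ?f = "\<lambda>S. Poly_Mapping.lookup \<theta> S \<cdot>\<^sub>s
      (if i \<in> S then (- 1) ^ card {j \<in> S. j < i} \<cdot>\<^sub>s bvec (S - {i}) else 0 :: nat set \<Rightarrow>\<^sub>0 int)"
  have "Poly_Mapping.keys (?f S) \<subseteq> {S. S \<subseteq> {2..d} \<and> card S = a - 1}"
    if "S \<in> Poly_Mapping.keys \<theta>" for S
  proof -
    have S: "S \<subseteq> {2..d}" "card S = a" using that assms by (auto simp: wedge0_def)
    then have "finite S" using finite_subset by blast
    with S show ?thesis
      by (auto simp: in_keys_iff lookup_smul bvec_def lookup_single split: if_splits)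
  qed
  moreover have "Poly_Mapping.keys (der i \<theta>) \<subseteq> (\<Union>S\<in>Poly_Mapping.keys \<theta>. Poly_Mapping.keys (?f S))"
    unfolding der_def linext_def by (rule keys_sum)
  ultimately show ?thesis unfolding wedge0_def by blast
qed

lemma tensor_in_wedge0_tensor:
  assumes "\<theta> \<in> wedge0 d a" "Poly_Mapping.keys \<nu> \<subseteq> mons 2 d b"
  shows "\<theta> \<otimes>\<^sub>t \<nu> \<in> wedge0_tensor d a b"
  using assms keys_tensor[of \<theta> \<nu>] unfolding wedge0_def wedge0_tensor_def by blast

lemma wedge0_tensor_sum:
  assumes "\<And>i. i \<in> A \<Longrightarrow> f i \<in> wedge0_tensor d a b"
  shows "sum f A \<in> wedge0_tensor d a b"
  using assms keys_sum[of f A] unfolding wedge0_tensor_def by blast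

lemma keys_bvec: "Poly_Mapping.keys (bvec b) \<subseteq> {b}"
  by (simp add: bvec_def)

lemma eta_in_Kmod:
  assumes "\<theta> \<in> wedge0 d a" "m \<in> mons 2 d b" "1 \<le> b"
  shows "eta d (\<theta> \<otimes>\<^sub>t bvec m) \<in> Kmod d (a - 1) (b - 1)"
proof -
  have "der i \<theta> \<otimes>\<^sub>t contr (bvec (xm i)) (bvec m) \<in> wedge0_tensor d (a - 1) (b - 1)" for i
  proof (rule tensor_in_wedge0_tensor[OF der_wedge0[OF assms(1)]])
    have "m - xm i \<in> mons 2 d (b - 1)" if "mdvd (xm i) m"
      by (rule mons_diff[of _ _ _ _ 1 _ i i]) (use assms that in \<open>auto intro: xm_mons\<close>)
    then show "Poly_Mapping.keys (contr (bvec (xm i)) (bvec m)) \<subseteq> mons 2 d (b - 1)"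
      by (auto simp: contr_bvec of_bool_def dest!: subsetD[OF keys_bvec])
  qed
  then show ?thesis
    unfolding Kmod_def by (simp add: eta_eta) (simp add: eta_tensor wedge0_tensor_sum)
qed

lemma kappa_in_Lmod:
  assumes "\<theta> \<in> wedge0 d a" "m \<in> mons 2 d b"
  shows "kappa d (\<theta> \<otimes>\<^sub>t bvec m) \<in> Lmod d (a - 1) (b + 1)"
proof -
  have "der i \<theta> \<otimes>\<^sub>t bvec (xm i + m) \<in> wedge0_tensor d (a - 1) (b + 1)" if "i \<in> {1..d}" for i
  proof (cases "i = 1")
    case True
    then show ?thesis
      by (simp add: der_one_wedge0[OF assms(1)] Modules.module_hom.zero[OF lin_tensor_left]
          wedge0_tensor_def)
  next
    case False
    then have "xm i \<in> mons 2 d 1" using that by (intro xm_mons) auto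
    from mons_add[OF this assms(2)] show ?thesis
      by (intro tensor_in_wedge0_tensor[OF der_wedge0[OF assms(1)]]) (simp add: bvec_def add.commute)
  qed
  then show ?thesis
    unfolding Lmod_def by (simp add: kappa_kappa) (auto simp: kappa_tensor intro!: wedge0_tensor_sum)
qed

section \<open>The differentials on the generators\<close>

lemmas eta_linear = lin_eta[THEN Modules.module_hom.add] lin_eta[THEN Modules.module_hom.scale]
  lin_eta[THEN Modules.module_hom.sum] lin_eta[THEN Modules.module_hom.zero]
lemmas kappa_linear = lin_kappa[THEN Modules.module_hom.add] lin_kappa[THEN Modules.module_hom.scale]
  lin_kappa[THEN Modules.module_hom.sum] lin_kappa[THEN Modules.module_hom.zero]
lemmas tensor_linear =
  lin_tensor_left[THEN Modules.module_hom.add] lin_tensor_left[THEN Modules.module_hom.scale]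
  lin_tensor_left[THEN Modules.module_hom.sum] lin_tensor_left[THEN Modules.module_hom.zero]
  lin_tensor_left[THEN Modules.module_hom.neg]
  lin_tensor_right[THEN Modules.module_hom.add] lin_tensor_right[THEN Modules.module_hom.scale]
  lin_tensor_right[THEN Modules.module_hom.sum] lin_tensor_right[THEN Modules.module_hom.zero]
  lin_tensor_right[THEN Modules.module_hom.neg]
lemmas linext_linear =
  lin_linext[THEN Modules.module_hom.scale]
  lin_linext[THEN Modules.module_hom.sum] lin_linext[THEN Modules.module_hom.zero]
lemmas contr_left_linear = lin_contr_left[THEN Modules.module_hom.add] lin_contr_left[THEN Modules.module_hom.scale]
  lin_contr_left[THEN Modules.module_hom.sum]
lemmas contr_right_linear = lin_contr_right[THEN Modules.module_hom.add] lin_contr_right[THEN Modules.module_hom.scale]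
  lin_contr_right[THEN Modules.module_hom.sum]
lemmas q_linear = lin_q[THEN Modules.module_hom.scale] lin_q[THEN Modules.module_hom.sum]
lemmas proj0_linear = lin_proj0[THEN Modules.module_hom.scale] lin_proj0[THEN Modules.module_hom.sum]

lemma sum_from_two:
  fixes f :: "nat \<Rightarrow> 'a::comm_monoid_add"
  assumes "f 1 = 0"
  shows "(\<Sum>i=1..d. f i) = (\<Sum>i=2..d. f i)"
proof (rule sum.mono_neutral_right)
  have "i = 1" if "i \<in> {1..d} - {2..d}" for i using that by auto
  then show "\<forall>i\<in>{1..d} - {2..d}. f i = 0" using assms by metis
qed auto

text \<open>
  In what follows, the condition \<open>der 1 \<theta> = 0\<close> is all that is used of \<open>\<theta>\<close> lying in
  \<open>\<RR> \<otimes> \<And>U\<^sub>0\<close>.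
\<close>

lemma eta_tensor_U0:
  "der 1 \<theta> = 0 \<Longrightarrow> eta d (\<theta> \<otimes>\<^sub>t \<nu>) = (\<Sum>i=2..d. der i \<theta> \<otimes>\<^sub>t contr (bvec (xm i)) \<nu>)"
  unfolding eta_tensor by (rule sum_from_two) (simp add: tensor_linear)

lemma kappa_tensor_U0:
  "der 1 \<theta> = 0 \<Longrightarrow> kappa d (\<theta> \<otimes>\<^sub>t bvec m) = (\<Sum>i=2..d. der i \<theta> \<otimes>\<^sub>t bvec (xm i + m))"
  unfolding kappa_tensor by (rule sum_from_two) (simp add: tensor_linear)

lemma Kos_U0: "der 1 \<theta> = 0 \<Longrightarrow> Kos d \<theta> = (\<Sum>i=2..d. rx i \<cdot>\<^sub>s der i \<theta>)"
  unfolding Kos_def by (rule sum_from_two) simp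

lemma der_one_der_zero: "der 1 \<theta> = 0 \<Longrightarrow> der 1 (der j \<theta>) = 0"
  using der_anticommute[of 1 j \<theta>] by (simp add: der_zero)

text \<open>
  For \<open>\<sigma> j = x\<^sub>j(m*)\<close> the inner sum on the right is \<open>\<eta>(x\<^sub>i*(\<theta>) \<otimes> m*)\<close>; for
  \<open>\<sigma> j = x\<^sub>j m\<close> it is \<open>\<kappa>(x\<^sub>i*(\<theta>) \<otimes> m)\<close>.
\<close>

lemma Kos_der:
  assumes "der 1 \<theta> = 0"
  shows "(\<Sum>j=2..d. Kos d (der j \<theta>) \<otimes>\<^sub>t \<sigma> j) = - (\<Sum>i=2..d. rx i \<cdot>\<^sub>s (\<Sum>j=2..d. der j (der i \<theta>) \<otimes>\<^sub>t \<sigma> j))"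
proof -
  have "(\<Sum>j=2..d. Kos d (der j \<theta>) \<otimes>\<^sub>t \<sigma> j) =
      (\<Sum>j=2..d. \<Sum>i=2..d. - (rx i \<cdot>\<^sub>s (der j (der i \<theta>) \<otimes>\<^sub>t \<sigma> j)))"
  proof (intro sum.cong refl)
    fix j
    have "Kos d (der j \<theta>) = (\<Sum>i=2..d. - (rx i \<cdot>\<^sub>s der j (der i \<theta>)))"
      by (subst Kos_U0[OF der_one_der_zero[OF assms]], subst der_anticommute) simp
    then show "Kos d (der j \<theta>) \<otimes>\<^sub>t \<sigma> j = (\<Sum>i=2..d. - (rx i \<cdot>\<^sub>s (der j (der i \<theta>) \<otimes>\<^sub>t \<sigma> j)))"
      by (simp add: tensor_linear)
  qed
  also have "\<dots> = - (\<Sum>i=2..d. rx i \<cdot>\<^sub>s (\<Sum>j=2..d. der j (der i \<theta>) \<otimes>\<^sub>t \<sigma> j))"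
    by (subst sum.swap) (simp add: smul.scale_sum_right sum_negf)
  finally show ?thesis .
qed

lemma linext_bilinear:
  assumes "\<And>m. lin (\<lambda>\<theta>. B \<theta> (bvec m))"
  shows "linext (\<lambda>(S, m). B (bvec S) (bvec m)) (\<theta> \<otimes>\<^sub>t bvec m) = B \<theta> (bvec m)"
  by (rule lin_eqI[of "\<lambda>\<theta>. linext (\<lambda>(S, m). B (bvec S) (bvec m)) (\<theta> \<otimes>\<^sub>t bvec m)"])
    (simp_all add: tensor_bvec assms lin_compose[OF lin_linext lin_tensor_left])

lemma lin_b_left:
  "lin (\<lambda>\<theta>. b_KK d n \<theta> \<nu>)" "lin (\<lambda>\<theta>. b_KL d n \<theta> \<nu>)"
  "lin (\<lambda>\<theta>. b_LK d n \<theta> \<nu>)" "lin (\<lambda>\<theta>. b_LL d n \<theta> \<nu>)"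
  unfolding b_KK_def b_KL_def b_LK_def b_LL_def by (intro lin_intros)+

lemma linext_eta:
  assumes "der 1 \<theta> = 0" "\<And>m. lin (\<lambda>\<theta>. B \<theta> (bvec m))"
  shows "linext (\<lambda>(S, m). B (bvec S) (bvec m)) (eta d (\<theta> \<otimes>\<^sub>t bvec m)) =
    (\<Sum>j=2..d. of_bool (mdvd (xm j) m) \<cdot>\<^sub>s B (der j \<theta>) (bvec (m - xm j)))"
  by (simp add: eta_tensor_U0[OF assms(1)] contr_bvec linext_linear tensor_linear
      linext_bilinear[of B, OF assms(2)])

lemma linext_kappa:
  assumes "der 1 \<theta> = 0" "\<And>m. lin (\<lambda>\<theta>. B \<theta> (bvec m))"
  shows "linext (\<lambda>(S, m). B (bvec S) (bvec m)) (kappa d (\<theta> \<otimes>\<^sub>t bvec m)) =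
    (\<Sum>j=2..d. B (der j \<theta>) (bvec (xm j + m)))"
  by (simp add: kappa_tensor_U0[OF assms(1)] linext_linear linext_bilinear[of B, OF assms(2)])

lemma mons2_diff_xm:
  assumes "m \<in> mons 2 d n" "1 \<le> n" "mdvd (xm j) m"
  shows "m - xm j \<in> mons 2 d (n - 1)"
  by (rule mons_diff[of _ _ _ _ 1 _ j j]) (use assms in \<open>auto intro: xm_mons\<close>)

lemma b_KK_eta:
  assumes d: "1 \<le> d" and n: "2 \<le> n" and \<theta>: "der 1 \<theta> = 0" and m: "m \<in> mons 2 d n"
  shows "linext (\<lambda>(S, m). b_KK d n (bvec S) (bvec m)) (eta d (\<theta> \<otimes>\<^sub>t bvec m)) =
    - (\<Sum>j=2..d. \<Sum>m1\<in>mons 1 d (n - 2). \<Sum>m2\<in>mons 2 d n.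
         (of_bool (mdvd (xm j) m) * rx 1 * rt (m1 + m2) * Q d n (xm 1 + m1) (m - xm j))
           \<cdot>\<^sub>s eta d (der j \<theta> \<otimes>\<^sub>t bvec m2))
    - delta d n \<cdot>\<^sub>s (\<Sum>j=2..d. rx j \<cdot>\<^sub>s eta d (der j \<theta> \<otimes>\<^sub>t bvec m))"
proof -
  let ?e = "\<lambda>j. of_bool (mdvd (xm j) m) :: rpoly"
  define A where "A j = eta d (der j \<theta> \<otimes>\<^sub>t bvec (xm 1 + (m - xm j)))" for j
  define S where "S j = (\<Sum>m1\<in>mons 1 d (n - 2). \<Sum>m2\<in>mons 2 d n.
      (?e j * rx 1 * rt (m1 + m2) * Q d n (xm 1 + m1) (m - xm j)) \<cdot>\<^sub>s eta d (der j \<theta> \<otimes>\<^sub>t bvec m2))" for j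
  \<comment> \<open>\<open>A j\<close> comes from the summand \<open>\<delta> (x\<^sub>1 m / x\<^sub>j)*\<close> of \<open>[q((m / x\<^sub>j)*)](\<Phi>~)\<close>.\<close>
  have step: "?e j \<cdot>\<^sub>s b_KK d n (der j \<theta>) (bvec (m - xm j)) =
      - ((rx 1 * delta d n) \<cdot>\<^sub>s (?e j \<cdot>\<^sub>s A j)) - S j
      + delta d n \<cdot>\<^sub>s (Kos d (der j \<theta>) \<otimes>\<^sub>t contr (bvec (xm j)) (bvec m))" for j
  proof (cases "mdvd (xm j) m")
    case True
    then have "m - xm j \<in> mons 1 d (n - 1)"
      using mons2_diff_xm[OF m] n mons2_subset by fastforce
    from contr_q_Phi_tilde[OF d n this] True show ?thesis
      by (simp add: b_KK_def tensor_linear eta_linear A_def S_def contr_bvec smul.scale_sum_right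
          smul.scale_right_distrib mult.assoc)
  qed (simp add: S_def contr_bvec tensor_linear)
  \<comment> \<open>For \<open>j\<close> at least 2, \<open>x\<^sub>j\<close> divides \<open>x\<^sub>1 m\<close> if and only if it divides \<open>m\<close>.\<close>
  have "(\<Sum>j=2..d. ?e j \<cdot>\<^sub>s A j) = eta d (eta d (\<theta> \<otimes>\<^sub>t bvec (xm 1 + m)))"
    unfolding eta_tensor_U0[OF \<theta>] eta_linear
  proof (intro sum.cong refl)
    fix j assume j: "j \<in> {2..d}"
    then have "mdvd (xm j) (xm 1 + m) \<longleftrightarrow> mdvd (xm j) m"
      by (auto simp: mdvd_xm lookup_add lookup_xm)
    moreover have "xm 1 + m - xm j = xm 1 + (m - xm j)" if "mdvd (xm j) m"
      using mon_add_cancel[of "xm 1" "xm j" "m - xm j"] mdvd_add_diff[OF that] by simp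
    ultimately show "?e j \<cdot>\<^sub>s A j = eta d (der j \<theta> \<otimes>\<^sub>t contr (bvec (xm j)) (bvec (xm 1 + m)))"
      by (auto simp: A_def contr_bvec tensor_linear eta_linear)
  qed
  then have A: "(\<Sum>j=2..d. ?e j \<cdot>\<^sub>s A j) = 0" by (simp add: eta_eta)
  have "(\<Sum>j=2..d. Kos d (der j \<theta>) \<otimes>\<^sub>t contr (bvec (xm j)) (bvec m)) =
      - (\<Sum>j=2..d. rx j \<cdot>\<^sub>s eta d (der j \<theta> \<otimes>\<^sub>t bvec m))"
    unfolding Kos_der[OF \<theta>] eta_tensor_U0[OF der_one_der_zero[OF \<theta>]] ..
  then show ?thesis
    unfolding linext_eta[of \<theta> "b_KK d n", OF \<theta> lin_b_left(1)] step
    by (simp only: sum.distrib sum_subtractf sum_negf A S_def smul.scale_sum_right[symmetric]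
        smul.scale_minus_right) simp
qed

lemma b_KL_eta:
  assumes \<theta>: "der 1 \<theta> = 0"
  shows "linext (\<lambda>(S, m). b_KL d n (bvec S) (bvec m)) (eta d (\<theta> \<otimes>\<^sub>t bvec m)) =
    - (\<Sum>j=2..d. \<Sum>m1\<in>mons 2 d (n - 1).
         (of_bool (mdvd (xm j) m) * rx 1 * Q d n m1 (m - xm j)) \<cdot>\<^sub>s kappa d (der j \<theta> \<otimes>\<^sub>t bvec m1))"
  unfolding linext_eta[of \<theta> "b_KL d n", OF \<theta> lin_b_left(2)]
  by (simp add: b_KL_def proj0_q tensor_linear kappa_linear smul.scale_sum_right sum_negf mult.assoc)

lemma q_contr_Phi_tilde:
  assumes "1 \<le> d" "2 \<le> n" "m \<in> mons 2 d n"
  shows "q d n (contr (bvec m) (Phi_tilde d n)) =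
    (\<Sum>m1\<in>mons 1 d (n - 2). rt (m1 + m) \<cdot>\<^sub>s q d n (bvec (xm 1 + m1)))"
  by (simp add: contr_Phi_tilde_mons2[OF assms] q_linear)

lemma mons2_add_xm:
  assumes "m \<in> mons 2 d (n - 1)" "2 \<le> n" "j \<in> {2..d}"
  shows "xm j + m \<in> mons 2 d n"
proof -
  have "xm j \<in> mons 2 d 1" using assms(3) by (intro xm_mons) auto
  from mons_add[OF this assms(1)] show ?thesis using assms(2) by simp
qed

lemma xm_one_add_mons:
  assumes "m1 \<in> mons 1 d (n - 2)" "1 \<le> d" "2 \<le> n"
  shows "xm 1 + m1 \<in> mons 1 d (n - 1)"
proof -
  have "xm 1 \<in> mons 1 d 1" using assms(2) by (intro xm_mons) auto
  moreover have "1 + (n - 2) = n - 1" using assms(3) by simp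
  ultimately show ?thesis using mons_add assms(1) by metis
qed

lemma b_LK_kappa:
  assumes d: "1 \<le> d" and n: "2 \<le> n" and \<theta>: "der 1 \<theta> = 0" and m: "m \<in> mons 2 d (n - 1)"
  shows "linext (\<lambda>(S, m). b_LK d n (bvec S) (bvec m)) (kappa d (\<theta> \<otimes>\<^sub>t bvec m)) =
    (\<Sum>j=2..d. \<Sum>m1\<in>mons 1 d (n - 2). \<Sum>m2\<in>mons 1 d (n - 2). \<Sum>m3\<in>mons 2 d n.
       (rx 1 * rt (xm j + m + m2) * Q d n (xm 1 + m1) (xm 1 + m2) * rt (m1 + m3))
         \<cdot>\<^sub>s eta d (der j \<theta> \<otimes>\<^sub>t bvec m3))"
proof -
  \<comment> \<open>\<open>A j\<close> collects the summands \<open>\<delta> (x\<^sub>1\<^sup>2 m2)*\<close> of \<open>[q((x\<^sub>1 m2)*)](\<Phi>~)\<close>.\<close>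
  define A where "A j = (\<Sum>m2\<in>mons 1 d (n - 2).
      rt (xm j + m + m2) \<cdot>\<^sub>s eta d (der j \<theta> \<otimes>\<^sub>t bvec (xm 1 + (xm 1 + m2))))" for j
  define S where "S j = (\<Sum>m2\<in>mons 1 d (n - 2). \<Sum>m1\<in>mons 1 d (n - 2). \<Sum>m3\<in>mons 2 d n.
       (rx 1 * rt (xm j + m + m2) * Q d n (xm 1 + m1) (xm 1 + m2) * rt (m1 + m3))
         \<cdot>\<^sub>s eta d (der j \<theta> \<otimes>\<^sub>t bvec m3))" for j
  have step: "b_LK d n (der j \<theta>) (bvec (xm j + m)) = (rx 1 * delta d n) \<cdot>\<^sub>s A j + S j"
    if j: "j \<in> {2..d}" for j
  proof -
    have "contr (q d n (contr (bvec (xm j + m)) (Phi_tilde d n))) (Phi_tilde d n) =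
      (\<Sum>m2\<in>mons 1 d (n - 2). rt (m2 + (xm j + m)) \<cdot>\<^sub>s
        (delta d n \<cdot>\<^sub>s bvec (xm 1 + (xm 1 + m2)) +
         (\<Sum>m1\<in>mons 1 d (n - 2). \<Sum>m3\<in>mons 2 d n.
           (rt (m1 + m3) * Q d n (xm 1 + m1) (xm 1 + m2)) \<cdot>\<^sub>s bvec m3)))"
      unfolding q_contr_Phi_tilde[OF d n mons2_add_xm[OF m n j]] contr_left_linear
      by (intro sum.cong refl) (simp only: contr_q_Phi_tilde[OF d n xm_one_add_mons[OF _ d n]])
    then show ?thesis
      by (simp add: b_LK_def A_def S_def tensor_linear eta_linear smul.scale_sum_right
          smul.scale_right_distrib sum.distrib ac_simps)
  qed
  \<comment> \<open>The summation over \<open>m2\<close> in \<open>A j\<close> is the contraction of \<open>\<Psi>\<close> by \<open>x\<^sub>j\<close>: for \<open>j\<close> at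
     least 2, \<open>x\<^sub>j\<close> divides \<open>x\<^sub>1\<^sup>2 k\<close> only if it divides \<open>k\<close>.\<close>
  define \<Psi> where "\<Psi> = (\<Sum>k\<in>mons 1 d (n - 2 + 1). rt (k + m) \<cdot>\<^sub>s bvec (xm 1 + (xm 1 + k)))"
  have "contr (bvec (xm j)) \<Psi> = (\<Sum>m2\<in>mons 1 d (n - 2). rt (xm j + m + m2) \<cdot>\<^sub>s bvec (xm 1 + (xm 1 + m2)))"
    if j: "j \<in> {2..d}" for j
  proof -
    have dvd: "mdvd (xm j) (xm 1 + (xm 1 + k)) \<longleftrightarrow> mdvd (xm j) k" for k
      using j by (auto simp: mdvd_xm lookup_add lookup_xm)
    have "contr (bvec (xm j)) \<Psi> = (\<Sum>k\<in>mons 1 d (n - 2 + 1). if mdvd (xm j) k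
        then rt (k + m) \<cdot>\<^sub>s bvec (xm 1 + (xm 1 + k) - xm j) else 0)"
      unfolding \<Psi>_def contr_right_linear contr_bvec dvd by (intro sum.cong refl) auto
    also have "\<dots> = (\<Sum>l\<in>mons 1 d (n - 2). rt (xm j + l + m) \<cdot>\<^sub>s bvec (xm 1 + (xm 1 + (xm j + l)) - xm j))"
      using j by (intro sum_mons_multiples xm_mons) auto
    also have "\<dots> = (\<Sum>l\<in>mons 1 d (n - 2). rt (xm j + m + l) \<cdot>\<^sub>s bvec (xm 1 + (xm 1 + l)))"
    proof (intro sum.cong refl)
      fix l
      have "xm 1 + (xm 1 + (xm j + l)) - xm j = xm 1 + (xm 1 + l)"
        using mon_add_cancel[of "xm 1 + xm 1" "xm j" l] by (simp add: add.assoc)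
      then show "rt (xm j + l + m) \<cdot>\<^sub>s bvec (xm 1 + (xm 1 + (xm j + l)) - xm j) =
          rt (xm j + m + l) \<cdot>\<^sub>s bvec (xm 1 + (xm 1 + l))"
        by (simp add: ac_simps)
    qed
    finally show ?thesis .
  qed
  then have "(\<Sum>j=2..d. A j) = eta d (eta d (\<theta> \<otimes>\<^sub>t \<Psi>))"
    unfolding eta_tensor_U0[OF \<theta>] eta_linear A_def
    by (intro sum.cong refl) (simp add: tensor_linear eta_linear)
  then have A: "(\<Sum>j=2..d. A j) = 0" by (simp add: eta_eta)
  have "linext (\<lambda>(S, m). b_LK d n (bvec S) (bvec m)) (kappa d (\<theta> \<otimes>\<^sub>t bvec m)) =
      (\<Sum>j=2..d. (rx 1 * delta d n) \<cdot>\<^sub>s A j + S j)"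
    unfolding linext_kappa[of \<theta> "b_LK d n", OF \<theta> lin_b_left(3)]
    by (intro sum.cong refl step)
  also have "\<dots> = (\<Sum>j=2..d. S j)"
    by (simp add: sum.distrib A flip: smul.scale_sum_right)
  finally show ?thesis unfolding S_def by (subst (asm) (2) sum.swap) simp
qed

lemma b_LL_kappa:
  assumes d: "1 \<le> d" and n: "2 \<le> n" and \<theta>: "der 1 \<theta> = 0" and m: "m \<in> mons 2 d (n - 1)"
  shows "linext (\<lambda>(S, m). b_LL d n (bvec S) (bvec m)) (kappa d (\<theta> \<otimes>\<^sub>t bvec m)) =
    (\<Sum>j=2..d. \<Sum>m1\<in>mons 2 d (n - 1). \<Sum>m2\<in>mons 1 d (n - 2).
       (rx 1 * rt (xm j + m + m2) * Q d n m1 (xm 1 + m2)) \<cdot>\<^sub>s kappa d (der j \<theta> \<otimes>\<^sub>t bvec m1))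
    - delta d n \<cdot>\<^sub>s (\<Sum>j=2..d. rx j \<cdot>\<^sub>s kappa d (der j \<theta> \<otimes>\<^sub>t bvec m))"
proof -
  have step: "b_LL d n (der j \<theta>) (bvec (xm j + m)) =
      (\<Sum>m1\<in>mons 2 d (n - 1). \<Sum>m2\<in>mons 1 d (n - 2).
       (rx 1 * rt (xm j + m + m2) * Q d n m1 (xm 1 + m2)) \<cdot>\<^sub>s kappa d (der j \<theta> \<otimes>\<^sub>t bvec m1))
      + delta d n \<cdot>\<^sub>s (Kos d (der j \<theta>) \<otimes>\<^sub>t bvec (xm j + m))" if j: "j \<in> {2..d}" for j
    unfolding b_LL_def q_contr_Phi_tilde[OF d n mons2_add_xm[OF m n j]] proj0_linear proj0_q
    by (subst sum.swap)
      (simp add: tensor_linear kappa_linear smul.scale_sum_right ac_simps)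
  have "(\<Sum>j=2..d. Kos d (der j \<theta>) \<otimes>\<^sub>t bvec (xm j + m)) =
      - (\<Sum>j=2..d. rx j \<cdot>\<^sub>s kappa d (der j \<theta> \<otimes>\<^sub>t bvec m))"
    unfolding Kos_der[OF \<theta>] kappa_tensor_U0[OF der_one_der_zero[OF \<theta>]] ..
  then show ?thesis
    unfolding linext_kappa[of \<theta> "b_LL d n", OF \<theta> lin_b_left(4)]
    by (simp add: step sum.distrib flip: smul.scale_sum_right)
qed

section \<open>The map to the ring and the conclusion\<close>

lemma in_R_superset:
  assumes "finite A" "Poly_Mapping.keys u \<subseteq> A"
  shows "in_R u = (\<Sum>m\<in>A. Poly_Mapping.lookup u m * rmon m)"
  unfolding in_R_def using assms by (intro sum.mono_neutral_left) (auto simp: in_keys_iff)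

lemma in_R_add: "in_R (u + v) = in_R u + in_R v"
proof -
  let ?A = "Poly_Mapping.keys u \<union> Poly_Mapping.keys v"
  have "Poly_Mapping.keys (u + v) \<subseteq> ?A" by (rule Poly_Mapping.keys_add)
  then show ?thesis
    by (simp add: in_R_superset[of ?A] lookup_add distrib_right sum.distrib)
qed

lemma in_R_smul: "in_R (c \<cdot>\<^sub>s u) = c * in_R u"
proof -
  have "Poly_Mapping.keys (c \<cdot>\<^sub>s u) \<subseteq> Poly_Mapping.keys u"
    by (auto simp: in_keys_iff lookup_smul)
  then show ?thesis
    by (simp add: in_R_superset[of "Poly_Mapping.keys u"] lookup_smul sum_distrib_left mult.assoc)
qed

lemma in_R_sum: "in_R (\<Sum>i\<in>I. u i) = (\<Sum>i\<in>I. in_R (u i))"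
  by (induction I rule: infinite_finite_induct) (simp_all add: in_R_add, simp_all add: in_R_def)

lemma in_R_bvec: "in_R (bvec m) = rmon m"
  by (simp add: in_R_def bvec_def)

lemma in_R_q: "in_R (q d n (bvec m)) = (\<Sum>m1\<in>mons 1 d (n - 1). rmon m1 * Q d n m1 m)"
  by (simp add: q_bvec in_R_sum in_R_smul in_R_bvec mult.commute)

lemma b_oneK_bvec: "b_oneK d n (bvec m) = (\<Sum>m1\<in>mons 1 d (n - 1). rx 1 * rmon m1 * Q d n m1 m)"
  by (simp add: b_oneK_def in_R_q sum_distrib_left mult.assoc)

lemma b_oneL_bvec:
  assumes "1 \<le> d" "2 \<le> n" "m \<in> mons 2 d n"
  shows "b_oneL d n (bvec m) = delta d n * rmon m
    - (\<Sum>m1\<in>mons 1 d (n - 2). \<Sum>m2\<in>mons 1 d (n - 1).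
         rx 1 * rmon m2 * Q d n m2 (xm 1 + m1) * rt (m1 + m))"
  by (simp add: b_oneL_def in_R_bvec q_contr_Phi_tilde[OF assms] in_R_sum in_R_smul in_R_q
      sum_distrib_left ac_simps)

lemma b_one_bvec:
  "b_one d n (bvec (S, m), 0) = b_oneK d n (bvec m)"
  "b_one d n (0, bvec (S, m)) = b_oneL d n (bvec m)"
  by (simp_all add: b_one_def bvec_def)

lemma Rset_rt_add:
  assumes "m1 \<in> mons 1 d (n - 2)" "m2 \<in> mons 2 d n" "2 \<le> n"
  shows "rt (m1 + m2) \<in> Rset d n"
proof -
  have "m2 \<in> mons 1 d n" "n - 2 + n = 2 * n - 2" using assms mons2_subset by auto
  then show ?thesis using mons_add[OF assms(1), of m2 n] by (intro Rset_rt) simp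
qed

lemma empty_in_wedge0_tensor:
  assumes "m \<in> mons 2 d b"
  shows "bvec {} \<otimes>\<^sub>t bvec m \<in> wedge0_tensor d 0 b"
  using assms by (intro tensor_in_wedge0_tensor) (auto simp: wedge0_def bvec_def)

lemma empty_in_Kmod:
  assumes "m \<in> mons 2 d b"
  shows "bvec {} \<otimes>\<^sub>t bvec m \<in> Kmod d 0 b"
  using empty_in_wedge0_tensor[OF assms] by (simp add: Kmod_def eta_tensor der_bvec tensor_linear)

lemma empty_in_Lmod:
  assumes "m \<in> mons 2 d b"
  shows "bvec {} \<otimes>\<^sub>t bvec m \<in> Lmod d 0 b"
  using empty_in_wedge0_tensor[OF assms] by (simp add: Lmod_def kappa_tensor der_bvec tensor_linear)

lemma linext_zero: "linext f 0 = 0"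
  by (simp add: linext_def)

theorem proposition8p2:
  fixes d n :: nat
  assumes "3 \<le> d" and "2 \<le> n"
  shows
    "(\<forall>m\<in>mons 2 d (n - 1).
        bvec {} \<otimes>\<^sub>t bvec m \<in> Kmod d 0 (n - 1) \<and>
        b_one d n (bc (bvec {} \<otimes>\<^sub>t bvec m), 0) \<in> B_zero d n \<and>
        b_one d n (bc (bvec {} \<otimes>\<^sub>t bvec m), 0) =
          (\<Sum>m1\<in>mons 1 d (n - 1). rx 1 * rmon m1 * Q d n m1 m))
     \<and>
     (\<forall>m\<in>mons 2 d n.
        bvec {} \<otimes>\<^sub>t bvec m \<in> Lmod d 0 n \<and>
        b_one d n (0, bc (bvec {} \<otimes>\<^sub>t bvec m)) \<in> B_zero d n \<and>
        b_one d n (0, bc (bvec {} \<otimes>\<^sub>t bvec m)) =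
          delta d n * rmon m
          - (\<Sum>m1\<in>mons 1 d (n - 2). \<Sum>m2\<in>mons 1 d (n - 1).
               rx 1 * rmon m2 * Q d n m2 (xm 1 + m1) * rt (m1 + m)))
     \<and>
     (\<forall>r. 2 \<le> r \<and> r \<le> d - 1 \<longrightarrow>
        (\<forall>\<theta>\<in>wedge0 d r. \<forall>m\<in>mons 2 d n.
           eta d (\<theta> \<otimes>\<^sub>t bvec m) \<in> Kmod d (r - 1) (n - 1) \<and>
           b_mid d n (bc (eta d (\<theta> \<otimes>\<^sub>t bvec m)), 0) \<in> B_mid d n (r - 1) \<and>
           b_mid d n (bc (eta d (\<theta> \<otimes>\<^sub>t bvec m)), 0) =
             (- (\<Sum>j=2..d. \<Sum>m1\<in>mons 1 d (n - 2). \<Sum>m2\<in>mons 2 d n.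
                   (of_bool (mdvd (xm j) m) * rx 1 * rt (m1 + m2) * Q d n (xm 1 + m1) (m - xm j))
                     \<cdot>\<^sub>s bc (eta d (der j \<theta> \<otimes>\<^sub>t bvec m2)))
              - delta d n \<cdot>\<^sub>s (\<Sum>j=2..d. rx j \<cdot>\<^sub>s bc (eta d (der j \<theta> \<otimes>\<^sub>t bvec m))),
              - (\<Sum>j=2..d. \<Sum>m1\<in>mons 2 d (n - 1).
                   (of_bool (mdvd (xm j) m) * rx 1 * Q d n m1 (m - xm j))
                     \<cdot>\<^sub>s bc (kappa d (der j \<theta> \<otimes>\<^sub>t bvec m1)))))
        \<and>
        (\<forall>\<theta>\<in>wedge0 d r. \<forall>m\<in>mons 2 d (n - 1).
           kappa d (\<theta> \<otimes>\<^sub>t bvec m) \<in> Lmod d (r - 1) n \<and>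
           b_mid d n (0, bc (kappa d (\<theta> \<otimes>\<^sub>t bvec m))) \<in> B_mid d n (r - 1) \<and>
           b_mid d n (0, bc (kappa d (\<theta> \<otimes>\<^sub>t bvec m))) =
             (\<Sum>j=2..d. \<Sum>m1\<in>mons 1 d (n - 2). \<Sum>m2\<in>mons 1 d (n - 2). \<Sum>m3\<in>mons 2 d n.
                (rx 1 * rt (xm j + m + m2) * Q d n (xm 1 + m1) (xm 1 + m2) * rt (m1 + m3))
                  \<cdot>\<^sub>s bc (eta d (der j \<theta> \<otimes>\<^sub>t bvec m3)),
              (\<Sum>j=2..d. \<Sum>m1\<in>mons 2 d (n - 1). \<Sum>m2\<in>mons 1 d (n - 2).
                 (rx 1 * rt (xm j + m + m2) * Q d n m1 (xm 1 + m2))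
                   \<cdot>\<^sub>s bc (kappa d (der j \<theta> \<otimes>\<^sub>t bvec m1)))
              - delta d n \<cdot>\<^sub>s (\<Sum>j=2..d. rx j \<cdot>\<^sub>s bc (kappa d (der j \<theta> \<otimes>\<^sub>t bvec m))))))
     \<and>
     (\<forall>\<theta>\<in>wedge0 d (d - 1).
        bc \<theta> \<in> B_top d n \<and>
        b_top d n (bc \<theta>) \<in> B_mid d n (d - 1) \<and>
        b_top d n (bc \<theta>) =
          (\<Sum>m\<in>mons 2 d n.
             (delta d n * rmon m
              - (\<Sum>m1\<in>mons 1 d (n - 2). \<Sum>m2\<in>mons 1 d (n - 1).
                   rx 1 * rmon m2 * Q d n m2 (xm 1 + m1) * rt (m1 + m)))
               \<cdot>\<^sub>s bc (eta d (\<theta> \<otimes>\<^sub>t bvec m)),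
           - (\<Sum>m\<in>mons 2 d (n - 1). \<Sum>m1\<in>mons 1 d (n - 1).
                (rx 1 * rmon m1 * Q d n m1 m) \<cdot>\<^sub>s bc (kappa d (\<theta> \<otimes>\<^sub>t bvec m)))))"
proof (intro conjI ballI allI impI)
  have d: "1 \<le> d" and n: "2 \<le> n" using assms by auto
  note R = Rset_sum Rset_mult Rset_diff Rset_delta Rset_Q Rset_rmon Rset_rx
  {
    fix m assume m: "m \<in> mons 2 d (n - 1)"
    show "bvec {} \<otimes>\<^sub>t bvec m \<in> Kmod d 0 (n - 1)" by (rule empty_in_Kmod[OF m])
    show eq: "b_one d n (bc (bvec {} \<otimes>\<^sub>t bvec m), 0) =
        (\<Sum>m1\<in>mons 1 d (n - 1). rx 1 * rmon m1 * Q d n m1 m)"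
      by (simp add: tensor_bvec b_one_bvec b_oneK_bvec)
    show "b_one d n (bc (bvec {} \<otimes>\<^sub>t bvec m), 0) \<in> B_zero d n"
      unfolding eq B_zero_def using d m mons2_subset by (intro R) auto
  next
    fix m assume m: "m \<in> mons 2 d n"
    show "bvec {} \<otimes>\<^sub>t bvec m \<in> Lmod d 0 n" by (rule empty_in_Lmod[OF m])
    show eq: "b_one d n (0, bc (bvec {} \<otimes>\<^sub>t bvec m)) = delta d n * rmon m
          - (\<Sum>m1\<in>mons 1 d (n - 2). \<Sum>m2\<in>mons 1 d (n - 1).
               rx 1 * rmon m2 * Q d n m2 (xm 1 + m1) * rt (m1 + m))"
      by (simp add: tensor_bvec b_one_bvec b_oneL_bvec[OF d n m])
    show "b_one d n (0, bc (bvec {} \<otimes>\<^sub>t bvec m)) \<in> B_zero d n"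
      unfolding eq B_zero_def using d m n mons2_subset
      by (intro R Rset_rt_add xm_one_add_mons) auto
  next
    fix r \<theta> m assume r: "2 \<le> r \<and> r \<le> d - 1" and \<theta>: "\<theta> \<in> wedge0 d r" and m: "m \<in> mons 2 d n"
    have 1: "der 1 (bc \<theta>) = 0"
      using der_one_wedge0[OF \<theta>] by (simp flip: bc_der)
    show "eta d (\<theta> \<otimes>\<^sub>t bvec m) \<in> Kmod d (r - 1) (n - 1)"
      using n by (intro eta_in_Kmod[OF \<theta> m]) simp
    show eq: "b_mid d n (bc (eta d (\<theta> \<otimes>\<^sub>t bvec m)), 0) =
             (- (\<Sum>j=2..d. \<Sum>m1\<in>mons 1 d (n - 2). \<Sum>m2\<in>mons 2 d n.
                   (of_bool (mdvd (xm j) m) * rx 1 * rt (m1 + m2) * Q d n (xm 1 + m1) (m - xm j))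
                     \<cdot>\<^sub>s bc (eta d (der j \<theta> \<otimes>\<^sub>t bvec m2)))
              - delta d n \<cdot>\<^sub>s (\<Sum>j=2..d. rx j \<cdot>\<^sub>s bc (eta d (der j \<theta> \<otimes>\<^sub>t bvec m))),
              - (\<Sum>j=2..d. \<Sum>m1\<in>mons 2 d (n - 1).
                   (of_bool (mdvd (xm j) m) * rx 1 * Q d n m1 (m - xm j))
                     \<cdot>\<^sub>s bc (kappa d (der j \<theta> \<otimes>\<^sub>t bvec m1))))"
      by (simp add: b_mid_def bc_eta bc_kappa bc_tensor bc_der linext_zero
          b_KK_eta[OF d n 1 m] b_KL_eta[OF 1])
    have K: "eta d (der j \<theta> \<otimes>\<^sub>t bvec m2) \<in> Kmod d (r - 1 - 1) (n - 1)" if "m2 \<in> mons 2 d n" for j m2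
      using n by (intro eta_in_Kmod[OF der_wedge0[OF \<theta>] that]) simp
    have L: "kappa d (der j \<theta> \<otimes>\<^sub>t bvec m1) \<in> Lmod d (r - 1 - 1) n" if "m1 \<in> mons 2 d (n - 1)" for j m1
      using kappa_in_Lmod[OF der_wedge0[OF \<theta>] that] n by simp
    \<comment> \<open>If \<open>x\<^sub>j\<close> does not divide \<open>m\<close>, then \<open>m - xm j = m\<close> has degree \<open>n\<close> and does not index
       \<open>Q\<close>; the coefficient is zero in this case.\<close>
    have D: "m - xm j \<in> mons 1 d (n - 1)" if "mdvd (xm j) m" for j
      using mons2_diff_xm[OF m _ that] n mons2_subset by fastforce
    have c1: "of_bool (mdvd (xm j) m) * rx 1 * rt (m1 + m2) * Q d n (xm 1 + m1) (m - xm j) \<in> Rset d n"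
      if "m1 \<in> mons 1 d (n - 2)" "m2 \<in> mons 2 d n" for j m1 m2
      using that d n by (cases "mdvd (xm j) m")
        (auto intro!: R Rset_rt_add xm_one_add_mons D Rset_zero)
    have c2: "of_bool (mdvd (xm j) m) * rx 1 * Q d n m1 (m - xm j) \<in> Rset d n"
      if "m1 \<in> mons 2 d (n - 1)" for j m1
      using that d mons2_subset by (cases "mdvd (xm j) m") (auto intro!: R D Rset_zero)
    show "b_mid d n (bc (eta d (\<theta> \<otimes>\<^sub>t bvec m)), 0) \<in> B_mid d n (r - 1)"
      unfolding eq B_mid_def
      by (intro SigmaI Rtensor_diff Rtensor_uminus Rtensor_smul[OF _ Rset_delta] Rtensor_sum Rtensor_base
          K L c1 c2 m) (auto intro: Rset_rx)
  next
    fix r \<theta> m assume r: "2 \<le> r \<and> r \<le> d - 1" and \<theta>: "\<theta> \<in> wedge0 d r" and m: "m \<in> mons 2 d (n - 1)"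
    have 1: "der 1 (bc \<theta>) = 0"
      using der_one_wedge0[OF \<theta>] by (simp flip: bc_der)
    show "kappa d (\<theta> \<otimes>\<^sub>t bvec m) \<in> Lmod d (r - 1) n"
      using kappa_in_Lmod[OF \<theta> m] n by simp
    show eq: "b_mid d n (0, bc (kappa d (\<theta> \<otimes>\<^sub>t bvec m))) =
             (\<Sum>j=2..d. \<Sum>m1\<in>mons 1 d (n - 2). \<Sum>m2\<in>mons 1 d (n - 2). \<Sum>m3\<in>mons 2 d n.
                (rx 1 * rt (xm j + m + m2) * Q d n (xm 1 + m1) (xm 1 + m2) * rt (m1 + m3))
                  \<cdot>\<^sub>s bc (eta d (der j \<theta> \<otimes>\<^sub>t bvec m3)),
              (\<Sum>j=2..d. \<Sum>m1\<in>mons 2 d (n - 1). \<Sum>m2\<in>mons 1 d (n - 2).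
                 (rx 1 * rt (xm j + m + m2) * Q d n m1 (xm 1 + m2))
                   \<cdot>\<^sub>s bc (kappa d (der j \<theta> \<otimes>\<^sub>t bvec m1)))
              - delta d n \<cdot>\<^sub>s (\<Sum>j=2..d. rx j \<cdot>\<^sub>s bc (kappa d (der j \<theta> \<otimes>\<^sub>t bvec m))))"
      by (simp add: b_mid_def bc_eta bc_kappa bc_tensor bc_der linext_zero
          b_LK_kappa[OF d n 1 m] b_LL_kappa[OF d n 1 m])
    have K: "eta d (der j \<theta> \<otimes>\<^sub>t bvec m2) \<in> Kmod d (r - 1 - 1) (n - 1)" if "m2 \<in> mons 2 d n" for j m2
      using n by (intro eta_in_Kmod[OF der_wedge0[OF \<theta>] that]) simp
    have L: "kappa d (der j \<theta> \<otimes>\<^sub>t bvec m1) \<in> Lmod d (r - 1 - 1) n" if "m1 \<in> mons 2 d (n - 1)" for j m1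
      using kappa_in_Lmod[OF der_wedge0[OF \<theta>] that] n by simp
    have t: "rt (xm j + m + m2) \<in> Rset d n" if "j \<in> {2..d}" "m2 \<in> mons 1 d (n - 2)" for j m2
      using Rset_rt_add[OF that(2) mons2_add_xm[OF m n that(1)] n] by (simp add: ac_simps)
    show "b_mid d n (0, bc (kappa d (\<theta> \<otimes>\<^sub>t bvec m))) \<in> B_mid d n (r - 1)"
      unfolding eq B_mid_def
      using d n mons2_subset
      by (intro SigmaI Rtensor_diff Rtensor_smul[OF _ Rset_delta] Rtensor_sum Rtensor_base
          Rset_mult Rset_Q K L t Rset_rt_add xm_one_add_mons m) (auto intro: Rset_rx)
  next
    fix \<theta> assume \<theta>: "\<theta> \<in> wedge0 d (d - 1)"
    show "bc \<theta> \<in> B_top d n"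
      using Rtensor_base[OF \<theta> Rset_one] by (simp add: B_top_def)
    show eq: "b_top d n (bc \<theta>) =
          (\<Sum>m\<in>mons 2 d n.
             (delta d n * rmon m
              - (\<Sum>m1\<in>mons 1 d (n - 2). \<Sum>m2\<in>mons 1 d (n - 1).
                   rx 1 * rmon m2 * Q d n m2 (xm 1 + m1) * rt (m1 + m)))
               \<cdot>\<^sub>s bc (eta d (\<theta> \<otimes>\<^sub>t bvec m)),
           - (\<Sum>m\<in>mons 2 d (n - 1). \<Sum>m1\<in>mons 1 d (n - 1).
                (rx 1 * rmon m1 * Q d n m1 m) \<cdot>\<^sub>s bc (kappa d (\<theta> \<otimes>\<^sub>t bvec m))))"
      unfolding b_top_def bc_eta bc_kappa bc_tensor bc_bvec smul.scale_sum_left[symmetric]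
      by (simp add: b_oneL_bvec[OF d n, unfolded b_oneL_def in_R_bvec]
          b_oneK_bvec[unfolded b_oneK_def])
    have K: "eta d (\<theta> \<otimes>\<^sub>t bvec m) \<in> Kmod d (d - 1 - 1) (n - 1)" if "m \<in> mons 2 d n" for m
      using n by (intro eta_in_Kmod[OF \<theta> that]) simp
    have L: "kappa d (\<theta> \<otimes>\<^sub>t bvec m) \<in> Lmod d (d - 1 - 1) n" if "m \<in> mons 2 d (n - 1)" for m
      using kappa_in_Lmod[OF \<theta> that] n by simp
    show "b_top d n (bc \<theta>) \<in> B_mid d n (d - 1)"
      unfolding eq B_mid_def using d n mons2_subset
      by (intro SigmaI Rtensor_uminus Rtensor_sum Rtensor_base K L R Rset_rt_add xm_one_add_mons) auto
  }
qed

end
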